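(* Let $1\le r<n$ and let $A\in\mathbb{R}^{n\times n}$ be symmetric with eigenvalue decomposition $A=V\Lambda V^{T}+V_\perp\Lambda_\perp V_\perp^{T}$, where $[V\; V_\perp]$ is orthogonal, $V\in\mathbb{R}^{n\times r}$, $V_\perp\in\mathbb{R}^{n\times(n-r)}$, $\Lambda=\mathrm{diag}(\lambda_1,\dots,\lambda_r)$, $\Lambda_\perp=\mathrm{diag}(\lambda_{r+1},\dots,\lambda_n)$, $\lambda_1\ge\dots\ge\lambda_r>\lambda_{r+1}\ge\dots\ge\lambda_n$, and $\min_{k\le r}|\lambda_k|>\max_{k>r}|\lambda_k|$. Suppose that $AQ-QS=E$ for some $Q\in\mathbb{R}^{n\times r}$ with orthonormal columns, some real diagonal matrix $S\in\mathbb{R}^{r\times r}$, and $E\in\mathbb{R}^{n\times r}$. Let $$\mathsf{gap}:=\min\{\lambda_r-\lambda_{r+1},\ \mathsf{sep}_{(2,\infty),V_\perp}(\Lambda,\,V_\perp\Lambda_\perp V_\perp^{T})\}.$$ If (the column span of) $Q$ is the leading invariant subspace of $A-EQ^{T}$ and $\|E\|_2\le\mathsf{gap}/5$, then $$\mathrm{dist}_{2\to\infty}(V,Q)\le 8\|V\|_{2\to\infty}\left(\frac{\|E\|_2}{\lambda_r-\lambda_{r+1}}\right)^{2}+2\|V_\perp V_\perp^{T}\|_\infty\frac{\|E\|_{2\to\infty}}{\mathsf{gap}}\cdot\left(1+\frac{2\|E\|_2}{\lambda_r-\lambda_{r+1}}\right).$$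
   Context: Norms: $\|\cdot\|_2$ is the spectral norm; $\|M\|_\infty=\max_i\|M_{i,:}\|_1$ (maximum absolute row sum); $\|M\|_{2\to\infty}=\max_i\|M_{i,:}\|_2$ (maximum Euclidean row norm). For $U,W\in\mathbb{R}^{n\times r}$ with orthonormal columns, $\mathrm{dist}_{2\to\infty}(U,W)=\inf_{O}\|U-WO\|_{2\to\infty}$, the infimum being over orthogonal $O\in\mathbb{R}^{r\times r}$. Separation: for $B\in\mathbb{R}^{r\times r}$, $C\in\mathbb{R}^{n\times n}$ and a matrix $W$ with $n$ rows, $\mathsf{sep}_{(2,\infty),W}(B,C)=\inf\{\|ZB-CZ\|_{2\to\infty}: Z\in\mathbb{R}^{n\times r},\ \|Z\|_{2\to\infty}=1,\ \text{every column of } Z \text{ lies in } \mathrm{range}(W)\}$. The leading ($r$-dimensional) invariant subspace of a matrix is the invariant subspace associated with its $r$ algebraically largest eigenvalues, counted with multiplicity (in the situation considered here, all eigenvalues of $A-EQ^{T}$ are real). *)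

theory Defs
  imports
    "Jordan_Normal_Form.Char_Poly"
    "Jordan_Normal_Form.Matrix_Kernel"
    Complex_Main
begin

section \<open>Norms\<close>

definition vec_norm2 :: "real vec \<Rightarrow> real" where
  "vec_norm2 v = sqrt (\<Sum>i<dim_vec v. (vec_index v i)\<^sup>2)"

definition vec_norm1 :: "real vec \<Rightarrow> real" where
  "vec_norm1 v = (\<Sum>i<dim_vec v. \<bar>vec_index v i\<bar>)"

text \<open>The supremum is meaningful for matrices with at least one column, and the maxima
  below for matrices with at least one row.\<close>

definition spectral_norm :: "real mat \<Rightarrow> real" where
  "spectral_norm M =
     Sup {vec_norm2 (M *\<^sub>v x) | x. x \<in> carrier_vec (dim_col M) \<and> vec_norm2 x = 1}"

definition norm_inf :: "real mat \<Rightarrow> real" where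
  "norm_inf M = Max ((\<lambda>i. vec_norm1 (row M i)) ` {..<dim_row M})"

definition norm_2_inf :: "real mat \<Rightarrow> real" where
  "norm_2_inf M = Max ((\<lambda>i. vec_norm2 (row M i)) ` {..<dim_row M})"


section \<open>Orthogonality and column spaces\<close>

text \<open>The library's \<open>orthogonal_mat\<close> only asks for nonzero, pairwise orthogonal columns,
  without normalization.\<close>

definition orthonormal_cols :: "real mat \<Rightarrow> bool" where
  "orthonormal_cols M \<longleftrightarrow> transpose_mat M * M = 1\<^sub>m (dim_col M)"

definition real_orthogonal :: "nat \<Rightarrow> real mat \<Rightarrow> bool" where
  "real_orthogonal k M \<longleftrightarrow> M \<in> carrier_mat k k \<and> orthonormal_cols M"

definition append_columns :: "real mat \<Rightarrow> real mat \<Rightarrow> real mat" where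
  "append_columns A B =
     four_block_mat A B (0\<^sub>m 0 (dim_col A)) (0\<^sub>m 0 (dim_col B))"

definition mat_range :: "real mat \<Rightarrow> real vec set" where
  "mat_range W = {W *\<^sub>v x | x. x \<in> carrier_vec (dim_col W)}"


section \<open>Distance and separation\<close>

definition dist_2_inf :: "real mat \<Rightarrow> real mat \<Rightarrow> real" where
  "dist_2_inf U W = Inf {norm_2_inf (U - W * R) | R. real_orthogonal (dim_col W) R}"

definition sep_2_inf :: "real mat \<Rightarrow> real mat \<Rightarrow> real mat \<Rightarrow> real" where
  "sep_2_inf W B C =
     Inf {norm_2_inf (Z * B - C * Z) | Z.
            Z \<in> carrier_mat (dim_row C) (dim_row B) \<and> norm_2_inf Z = 1 \<and>
            (\<forall>j<dim_col Z. col Z j \<in> mat_range W)}"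


section \<open>Leading invariant subspaces\<close>

text \<open>The list \<open>es\<close> enumerates the eigenvalues of \<open>M\<close>, all of them real, in
  nonincreasing order and with algebraic multiplicity. The columns of \<open>B\<close> form a basis
  of the subspace \<open>U\<close>, and \<open>M * B = B * T\<close> says that \<open>U\<close> is invariant and that \<open>T\<close>
  represents the restriction of \<open>M\<close> to \<open>U\<close>. If the \<open>r\<close>-th and the next entry of
  \<open>es\<close> differ, exactly one \<open>U\<close> satisfies the predicate.\<close>

definition leading_invariant_subspace :: "nat \<Rightarrow> real mat \<Rightarrow> real vec set \<Rightarrow> bool" where
  "leading_invariant_subspace r M U \<longleftrightarrow>
     (\<exists>es B T.
        length es = dim_row M \<and> sorted_wrt (\<ge>) es \<and>
        char_poly M = (\<Prod>e\<leftarrow>es. [:- e, 1:]) \<and>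
        B \<in> carrier_mat (dim_row M) r \<and> T \<in> carrier_mat r r \<and>
        mat_kernel B = {0\<^sub>v r} \<and> U = mat_range B \<and>
        M * B = B * T \<and>
        char_poly T = (\<Prod>e\<leftarrow>take r es. [:- e, 1:]))"

end

theory Submission
  imports Defs "Jordan_Normal_Form.Schur_Decomposition" "Jordan_Normal_Form.Spectral_Radius" "HOL-Analysis.L2_Norm"
begin

text \<open>Write \<open>Q = V * X + Vp * Y\<close>. The compression of \<open>A\<close> to the orthogonal complement of \<open>Q\<close> is
  symmetric and carries the remaining eigenvalues of \<open>A - E * Q\<^sup>T\<close>, so a Courant--Fischer argument
  keeps the entries of \<open>S\<close> within \<open>2 * \<parallel>E\<parallel>\<close> of \<open>\<lambda>\<^sub>r\<close> from below, and a Davis--Kahan argument bounds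
  \<open>Y\<close>. The orthogonal polar factor of \<open>X\<^sup>T\<close> aligns \<open>Q\<close> with \<open>V\<close> up to second order in \<open>Y\<close>, which
  gives the quadratic term. For the linear term, \<open>Z = Vp * Y\<close> is multiplied by \<open>X\<^sup>T\<close>: this turns
  the Sylvester operator with \<open>S\<close> into the one with \<open>\<Lambda>\<close>, for which the separation is available,
  without inverting \<open>X\<close>.\<close>

section \<open>Vector and matrix norms\<close>

text \<open>Obstacle one: \<open>A - E * Q\<^sup>T\<close> is not symmetric, so symmetric eigenvalue
  inequalities do not apply to it. They are applied to \<open>A\<close> alone, after a block
  triangular form has turned the hypothesis on \<open>Q\<close> into a bound on Rayleigh quotients
  of \<open>A\<close>. Obstacle two: \<open>C * Z - Z * S = Vp * (Vp\<^sup>T * E)\<close> involves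
  \<open>S\<close>, the separation involves \<open>L\<close>. The exchange rests on
  \<open>X\<^sup>T * L = (V\<^sup>T * E)\<^sup>T + S * X\<^sup>T\<close>; its price is the term
  \<open>Z * (V\<^sup>T * E)\<^sup>T\<close>, at most \<open>\<epsilon>\<close> times the norm of
  \<open>Z\<close>, which is absorbed because \<open>\<epsilon> \<le> gap / 5\<close>. Row norms are
  compatible with spectral bounds on right factors only: a right factor acts on each row by its
  transpose, while the left factor \<open>Vp * Vp\<^sup>T\<close> costs its absolute row sum.
  Constants: with 5 \<epsilon> \<le> \<delta> the Davis--Kahan gap \<delta> - 2 \<epsilon> is at
  least 3/5 \<delta>, so the squared norm of \<open>Y\<close> is at most 25/9
  (\<epsilon>/\<delta>)^2 and at most 1/9. Then \<open>X\<close> shrinks no vector below 8/9 of its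
  length, and 8/9 - 1/5 > 1/2 yields the factor 2 of the linear term.\<close>

lemma vec_norm2_eq_L2: "vec_norm2 v = L2_set (\<lambda>i. v $ i) {..<dim_vec v}"
  by (simp add: vec_norm2_def L2_set_def)

lemma vec_norm2_nonneg [simp]: "0 \<le> vec_norm2 v"
  by (simp add: vec_norm2_def sum_nonneg)

lemma vec_norm2_power2: "(vec_norm2 v)\<^sup>2 = v \<bullet> v"
  by (simp add: vec_norm2_def sum_nonneg scalar_prod_def power2_eq_square atLeast0LessThan)

lemma vec_norm2_power2_eq_sum:
  "v \<in> carrier_vec k \<Longrightarrow> (vec_norm2 v)\<^sup>2 = (\<Sum>i<k. (v $ i)\<^sup>2)"
  by (auto simp: vec_norm2_def sum_nonneg)

lemma vec_norm2_eq_0D: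
  assumes "v \<in> carrier_vec k" "vec_norm2 v = 0"
  shows "v = 0\<^sub>v k"
proof -
  have "v $ i = 0" if "i < k" for i
    using assms that by (auto simp: vec_norm2_eq_L2 L2_set_eq_0_iff)
  then show ?thesis using assms(1) by auto
qed

lemma vec_norm2_smult: "vec_norm2 (c \<cdot>\<^sub>v v) = \<bar>c\<bar> * vec_norm2 v"
  by (simp add: vec_norm2_def power_mult_distrib sum_distrib_left[symmetric] real_sqrt_mult)

lemma vec_norm2_triangle:
  assumes "u \<in> carrier_vec k" "v \<in> carrier_vec k"
  shows "vec_norm2 (u + v) \<le> vec_norm2 u + vec_norm2 v"
  using assms L2_set_triangle_ineq[of "($) u" "($) v" "{..<k}"]
  by (simp add: vec_norm2_eq_L2 L2_set_def)

lemma vec_norm2_diff_le: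
  assumes "u \<in> carrier_vec k" "v \<in> carrier_vec k"
  shows "vec_norm2 (u - v) \<le> vec_norm2 u + vec_norm2 v"
proof -
  have "u - v = u + (-1) \<cdot>\<^sub>v v" using assms by auto
  then show ?thesis
    using vec_norm2_triangle[of u k "(-1) \<cdot>\<^sub>v v"] assms by (simp add: vec_norm2_smult)
qed

lemma abs_scalar_prod_le:
  assumes "u \<in> carrier_vec k" "v \<in> carrier_vec k"
  shows "\<bar>u \<bullet> v\<bar> \<le> vec_norm2 u * vec_norm2 v"
proof -
  have "\<bar>u \<bullet> v\<bar> \<le> (\<Sum>i<k. \<bar>u $ i\<bar> * \<bar>v $ i\<bar>)"
    using assms by (simp add: scalar_prod_def atLeast0LessThan abs_mult[symmetric] sum_abs)
  also have "\<dots> \<le> L2_set (($) u) {..<k} * L2_set (($) v) {..<k}"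
    by (rule L2_set_mult_ineq)
  finally show ?thesis using assms by (simp add: vec_norm2_eq_L2)
qed

lemma vec_norm2_normalize:
  assumes "v \<in> carrier_vec k" "v \<noteq> 0\<^sub>v k"
  shows "vec_norm2 ((1 / vec_norm2 v) \<cdot>\<^sub>v v) = 1"
  using assms vec_norm2_eq_0D[of v k] by (auto simp: vec_norm2_smult)

lemma scalar_prod_mult_mat_vec:
  fixes M :: "real mat"
  assumes "M \<in> carrier_mat m k" "x \<in> carrier_vec k" "y \<in> carrier_vec m"
  shows "(M *\<^sub>v x) \<bullet> y = x \<bullet> (M\<^sup>T *\<^sub>v y)"
proof -
  have "x \<bullet> (M\<^sup>T *\<^sub>v y) = (M\<^sup>T *\<^sub>v y) \<bullet> x"
    using assms by (intro comm_scalar_prod[of _ k]) auto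
  also have "\<dots> = y \<bullet> (M *\<^sub>v x)"
    using assms by (intro transpose_vec_mult_scalar) auto
  also have "\<dots> = (M *\<^sub>v x) \<bullet> y"
    using assms by (intro comm_scalar_prod[of _ m]) auto
  finally show ?thesis by simp
qed

lemma scalar_prod_isometry:
  fixes W :: "real mat"
  assumes "W \<in> carrier_mat m k" "W\<^sup>T * W = 1\<^sub>m k" "x \<in> carrier_vec k" "y \<in> carrier_vec k"
  shows "(W *\<^sub>v x) \<bullet> (W *\<^sub>v y) = x \<bullet> y"
proof -
  have "(W *\<^sub>v x) \<bullet> (W *\<^sub>v y) = x \<bullet> (W\<^sup>T *\<^sub>v (W *\<^sub>v y))"
    using assms by (intro scalar_prod_mult_mat_vec) auto
  also have "W\<^sup>T *\<^sub>v (W *\<^sub>v y) = (W\<^sup>T * W) *\<^sub>v y"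
    using assms(1,4) by (intro assoc_mult_mat_vec[symmetric]) auto
  finally show ?thesis using assms by simp
qed

lemma vec_norm2_eqI: "u \<bullet> u = v \<bullet> v \<Longrightarrow> vec_norm2 u = vec_norm2 v"
  by (metis vec_norm2_nonneg vec_norm2_power2 power2_eq_imp_eq)

lemma vec_norm2_isometry:
  fixes W :: "real mat"
  assumes "W \<in> carrier_mat m k" "W\<^sup>T * W = 1\<^sub>m k" "x \<in> carrier_vec k"
  shows "vec_norm2 (W *\<^sub>v x) = vec_norm2 x"
  using assms by (intro vec_norm2_eqI scalar_prod_isometry) auto

text \<open>Duality: pair \<open>M\<^sup>T *\<^sub>v y\<close> with itself, move \<open>M\<close> to
  the other side, apply Cauchy--Schwarz and cancel one factor. The constant is a parameter so that
  the lemma serves isometries as well as \<open>Y\<close>.\<close>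

lemma transpose_mult_mat_vec_bound:
  fixes M :: "real mat"
  assumes M: "M \<in> carrier_mat m k" and c: "0 \<le> c"
    and bound: "\<And>x. x \<in> carrier_vec k \<Longrightarrow> vec_norm2 (M *\<^sub>v x) \<le> c * vec_norm2 x"
    and y: "y \<in> carrier_vec m"
  shows "vec_norm2 (M\<^sup>T *\<^sub>v y) \<le> c * vec_norm2 y"
proof (cases "vec_norm2 (M\<^sup>T *\<^sub>v y) = 0")
  case True
  then show ?thesis using c by simp
next
  case False
  let ?z = "M\<^sup>T *\<^sub>v y"
  have z: "?z \<in> carrier_vec k" using M y by auto
  have "vec_norm2 ?z * vec_norm2 ?z = (M *\<^sub>v ?z) \<bullet> y"
    using M y z by (simp add: vec_norm2_power2[symmetric] power2_eq_square[symmetric] scalar_prod_mult_mat_vec[OF M z y])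
  also have "\<dots> \<le> vec_norm2 (M *\<^sub>v ?z) * vec_norm2 y"
    using abs_scalar_prod_le[of "M *\<^sub>v ?z" m y] M y by auto
  also have "\<dots> \<le> c * vec_norm2 ?z * vec_norm2 y"
    using bound[OF z] by (intro mult_right_mono) auto
  also have "\<dots> = vec_norm2 ?z * (c * vec_norm2 y)" by simp
  finally show ?thesis
    using False vec_norm2_nonneg[of ?z] by (simp add: mult_le_cancel_left)
qed

text \<open>A real \<open>Sup\<close> dominates its members only once the set is bounded above.
  Cauchy--Schwarz in each coordinate gives the crude bound \<open>?c\<close>, the sum of the row
  norms; normalizing \<open>x\<close> does the rest.\<close>

lemma vec_norm2_mult_mat_vec_le_spectral_norm:
  assumes M: "M \<in> carrier_mat m k" and x: "x \<in> carrier_vec k"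
  shows "vec_norm2 (M *\<^sub>v x) \<le> spectral_norm M * vec_norm2 x"
proof (cases "x = 0\<^sub>v k")
  case True
  then show ?thesis using M by (simp add: vec_norm2_def)
next
  case False
  let ?S = "{vec_norm2 (M *\<^sub>v y) | y. y \<in> carrier_vec (dim_col M) \<and> vec_norm2 y = 1}"
  let ?c = "\<Sum>i<m. vec_norm2 (row M i)"
  have bdd: "bdd_above ?S"
  proof (rule bdd_aboveI)
    fix a assume "a \<in> ?S"
    then obtain y where y: "y \<in> carrier_vec k" "vec_norm2 y = 1" and a: "a = vec_norm2 (M *\<^sub>v y)"
      using M by auto
    have "a \<le> (\<Sum>i<m. \<bar>(M *\<^sub>v y) $ i\<bar>)"
      unfolding a vec_norm2_eq_L2 using M L2_set_le_sum_abs by (simp del: index_mult_mat_vec)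
    also have "\<dots> \<le> ?c"
    proof (rule sum_mono)
      fix i assume "i \<in> {..<m}"
      then show "\<bar>(M *\<^sub>v y) $ i\<bar> \<le> vec_norm2 (row M i)"
        using abs_scalar_prod_le[of "row M i" k y] M y by simp
    qed
    finally show "a \<le> ?c" .
  qed
  define t where "t = vec_norm2 x"
  have t: "t > 0"
    unfolding t_def using vec_norm2_eq_0D[OF x] False less_eq_real_def vec_norm2_nonneg by metis
  let ?y = "(1 / t) \<cdot>\<^sub>v x"
  have "vec_norm2 (M *\<^sub>v ?y) \<le> spectral_norm M"
    unfolding spectral_norm_def
    using vec_norm2_normalize[OF x False] x M t_def by (intro cSup_upper bdd) auto
  moreover have "vec_norm2 (M *\<^sub>v ?y) = vec_norm2 (M *\<^sub>v x) / t"
    using M x t by (subst mult_mat_vec[of M m k]) (auto simp: vec_norm2_smult)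
  ultimately show ?thesis using t by (simp add: t_def field_simps)
qed

lemma spectral_norm_nonneg:
  assumes "dim_col M > 0"
  shows "0 \<le> spectral_norm M"
proof -
  have u: "vec_norm2 (unit_vec (dim_col M) 0) = 1"
    using assms vec_norm2_power2[of "unit_vec (dim_col M) 0"] vec_norm2_nonneg[of "unit_vec (dim_col M) 0"]
    by (simp add: power2_eq_1_iff)
  show ?thesis
    using order_trans[OF vec_norm2_nonneg
        vec_norm2_mult_mat_vec_le_spectral_norm[of M "dim_row M" "dim_col M" "unit_vec (dim_col M) 0"]]
    by (simp add: u)
qed

lemma vec_norm2_row_le:
  assumes "M \<in> carrier_mat m k" "i < m"
  shows "vec_norm2 (row M i) \<le> norm_2_inf M"
  unfolding norm_2_inf_def using assms by (intro Max_ge) auto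

lemma norm_2_inf_le:
  assumes "M \<in> carrier_mat m k" "0 < m" "\<And>i. i < m \<Longrightarrow> vec_norm2 (row M i) \<le> c"
  shows "norm_2_inf M \<le> c"
  unfolding norm_2_inf_def using assms by (intro Max.boundedI) auto

lemma norm_2_inf_nonneg:
  assumes "M \<in> carrier_mat m k" "0 < m"
  shows "0 \<le> norm_2_inf M"
  using vec_norm2_row_le[OF assms(1,2)] vec_norm2_nonneg[of "row M 0"] by linarith

lemma norm_2_inf_attained:
  assumes "M \<in> carrier_mat m k" "0 < m"
  obtains i where "i < m" "norm_2_inf M = vec_norm2 (row M i)"
proof -
  have "norm_2_inf M \<in> (\<lambda>i. vec_norm2 (row M i)) ` {..<dim_row M}"
    unfolding norm_2_inf_def using assms by (intro Max_in) auto
  then show ?thesis using that assms by auto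
qed

lemma norm_2_inf_smult:
  assumes M: "M \<in> carrier_mat m k" "0 < m"
  shows "norm_2_inf (c \<cdot>\<^sub>m M) = \<bar>c\<bar> * norm_2_inf M"
proof -
  have row: "vec_norm2 (row (c \<cdot>\<^sub>m M) i) = \<bar>c\<bar> * vec_norm2 (row M i)" if "i < m" for i
    using that M by (simp add: vec_norm2_smult)
  obtain i where i: "i < m" "norm_2_inf M = vec_norm2 (row M i)"
    using norm_2_inf_attained[OF M] .
  have cM: "c \<cdot>\<^sub>m M \<in> carrier_mat m k" using M by simp
  show ?thesis
  proof (rule antisym)
    show "norm_2_inf (c \<cdot>\<^sub>m M) \<le> \<bar>c\<bar> * norm_2_inf M"
      using norm_2_inf_le[OF cM M(2)] row vec_norm2_row_le[OF M(1)] by (simp add: mult_left_mono)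
    show "\<bar>c\<bar> * norm_2_inf M \<le> norm_2_inf (c \<cdot>\<^sub>m M)"
      using vec_norm2_row_le[OF cM i(1)] row[OF i(1)] i(2) by simp
  qed
qed

text \<open>The bridge between the spectral and the row norm: a bound for \<open>M\<^sup>T\<close>
  on vectors becomes a bound for right multiplication by \<open>M\<close>, row by row.\<close>

lemma row_mult:
  fixes L :: "real mat"
  assumes "L \<in> carrier_mat m k" "M \<in> carrier_mat k l" "i < m"
  shows "row (L * M) i = M\<^sup>T *\<^sub>v row L i"
proof -
  have "row (L * M) i $ j = (M\<^sup>T *\<^sub>v row L i) $ j" if "j < l" for j
    using assms that by (simp add: comm_scalar_prod[of _ k])
  then show ?thesis using assms by (intro eq_vecI) auto
qed

lemma row_minus:
  fixes M N :: "real mat"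
  assumes "M \<in> carrier_mat m k" "N \<in> carrier_mat m k" "i < m"
  shows "row (M - N) i = row M i - row N i"
  using assms by (intro eq_vecI) auto

lemma row_minus_add:
  fixes M N P :: "real mat"
  assumes "M \<in> carrier_mat m k" "N \<in> carrier_mat m k" "P \<in> carrier_mat m k" "i < m"
  shows "row (M - (N + P)) i = row M i - row N i - row P i"
  using assms by (intro eq_vecI) auto

text \<open>The vector is the combination of the rows of \<open>M\<close> with coefficients
  \<open>a\<close>, so the triangle inequality applies term by term. The induction runs over index
  sets inside \<open>L2_set\<close>, which avoids finite sums of vectors.\<close>

lemma vec_norm2_sum_rows_le:
  assumes "M \<in> carrier_mat k l" "0 < k" "a \<in> carrier_vec k"
  shows "vec_norm2 (M\<^sup>T *\<^sub>v a) \<le> vec_norm1 a * norm_2_inf M"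
proof -
  have "L2_set (\<lambda>j. \<Sum>i\<in>I. a $ i * M $$ (i, j)) {..<l} \<le> (\<Sum>i\<in>I. \<bar>a $ i\<bar> * norm_2_inf M)"
    if "finite I" "I \<subseteq> {..<k}" for I
    using that
  proof (induction I)
    case empty
    then show ?case by (simp add: L2_set_def)
  next
    case (insert i I)
    have i: "i < k" using insert by auto
    have "L2_set (\<lambda>j. \<Sum>i\<in>insert i I. a $ i * M $$ (i, j)) {..<l}
        = L2_set (\<lambda>j. a $ i * M $$ (i, j) + (\<Sum>i\<in>I. a $ i * M $$ (i, j))) {..<l}"
      using insert by simp
    also have "\<dots> \<le> L2_set (\<lambda>j. a $ i * M $$ (i, j)) {..<l} + L2_set (\<lambda>j. \<Sum>i\<in>I. a $ i * M $$ (i, j)) {..<l}"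
      by (rule L2_set_triangle_ineq)
    also have "L2_set (\<lambda>j. a $ i * M $$ (i, j)) {..<l} = vec_norm2 (a $ i \<cdot>\<^sub>v row M i)"
      using assms i by (simp add: vec_norm2_eq_L2 L2_set_def)
    also have "\<dots> \<le> \<bar>a $ i\<bar> * norm_2_inf M"
      using vec_norm2_row_le[OF assms(1) i] by (simp add: vec_norm2_smult mult_left_mono)
    finally show ?case using insert by simp
  qed
  from this[of "{..<k}"]
  have "L2_set (\<lambda>j. \<Sum>i<k. a $ i * M $$ (i, j)) {..<l} \<le> vec_norm1 a * norm_2_inf M"
    using assms(3) by (simp add: vec_norm1_def sum_distrib_right)
  moreover have "(M\<^sup>T *\<^sub>v a) $ j = (\<Sum>i<k. a $ i * M $$ (i, j))" if "j < l" for j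
    using assms that by (simp add: scalar_prod_def atLeast0LessThan mult.commute)
  then have "L2_set (($) (M\<^sup>T *\<^sub>v a)) {..<l} = L2_set (\<lambda>j. \<Sum>i<k. a $ i * M $$ (i, j)) {..<l}"
    by (intro L2_set_cong) auto
  ultimately show ?thesis
    using assms(1) by (simp add: vec_norm2_eq_L2 del: index_mult_mat_vec)
qed

lemma norm_2_inf_mult_le:
  assumes L: "L \<in> carrier_mat m k" and M: "M \<in> carrier_mat k l" and "0 < m" "0 < k"
  shows "norm_2_inf (L * M) \<le> norm_inf L * norm_2_inf M"
proof (rule norm_2_inf_le)
  show "L * M \<in> carrier_mat m l" using L M by simp
  fix i assume i: "i < m"
  have "vec_norm2 (row (L * M) i) \<le> vec_norm1 (row L i) * norm_2_inf M"
    unfolding row_mult[OF L M i] using L M assms(4) i by (intro vec_norm2_sum_rows_le) auto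
  also have "vec_norm1 (row L i) \<le> norm_inf L"
    unfolding norm_inf_def using L i by (intro Max_ge) auto
  finally show "vec_norm2 (row (L * M) i) \<le> norm_inf L * norm_2_inf M"
    using norm_2_inf_nonneg[OF M assms(4)] by (simp add: mult_right_mono)
qed fact

section \<open>Orthonormal bases and the spectral theorem\<close>

text \<open>Padding with zero rows gives a square matrix; row \<open>m\<close> of it is zero, so its
  determinant vanishes and it has a kernel vector. This is the dimension count behind both basis
  extension and the Courant--Fischer step.\<close>

lemma wide_matrix_kernel:
  fixes M :: "real mat"
  assumes M: "M \<in> carrier_mat m k" and "m < k"
  obtains v where "v \<in> carrier_vec k" "M *\<^sub>v v = 0\<^sub>v m" "vec_norm2 v = 1"
proof -
  let ?N = "mat k k (\<lambda>(i, j). if i < m then M $$ (i, j) else 0)"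
  have N: "?N \<in> carrier_mat k k" by simp
  have "row ?N m = 0\<^sub>v k" using \<open>m < k\<close> by auto
  then have "?N $$ (m, j) = 0" if "j < k" for j using that \<open>m < k\<close> by simp
  then have "det ?N = 0"
    using laplace_expansion_row[OF N \<open>m < k\<close>] by simp
  then obtain v where v: "v \<in> carrier_vec k" "v \<noteq> 0\<^sub>v k" "?N *\<^sub>v v = 0\<^sub>v k"
    using det_0_iff_vec_prod_zero[OF N] by auto
  have "(M *\<^sub>v v) $ i = 0" if "i < m" for i
  proof -
    have "row ?N i = row M i" using that \<open>m < k\<close> M by (intro eq_vecI) auto
    moreover have "(?N *\<^sub>v v) $ i = row ?N i \<bullet> v" using that \<open>m < k\<close> by simp
    ultimately show ?thesis using v(3) that \<open>m < k\<close> M by simp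
  qed
  then have Mv: "M *\<^sub>v v = 0\<^sub>v m" using M by auto
  let ?w = "(1 / vec_norm2 v) \<cdot>\<^sub>v v"
  have "M *\<^sub>v ?w = 0\<^sub>v m" using M v(1) by (auto simp: mult_mat_vec[of M m k] Mv intro!: eq_vecI)
  then show ?thesis
    using that[of ?w] v(1) vec_norm2_normalize[OF v(1,2)] by simp
qed

text \<open>Lists rather than matrices, since bases grow here by appending one vector at a time;
  \<open>mat_of_cols\<close> converts back.\<close>

definition orthonormal_vecs :: "nat \<Rightarrow> real vec list \<Rightarrow> bool" where
  "orthonormal_vecs n us \<longleftrightarrow> set us \<subseteq> carrier_vec n \<and>
     (\<forall>i<length us. \<forall>j<length us. us ! i \<bullet> us ! j = (if i = j then 1 else 0))"

lemma orthonormal_vecs_nth: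
  assumes "orthonormal_vecs n us" "i < length us"
  shows "us ! i \<in> carrier_vec n"
    and "j < length us \<Longrightarrow> us ! i \<bullet> us ! j = (if i = j then 1 else 0)"
  using assms by (auto simp: orthonormal_vecs_def)

lemma orthonormal_vecs_appendD2:
  assumes "orthonormal_vecs n (us @ vs)"
  shows "orthonormal_vecs n vs"
proof -
  have "vs ! i \<bullet> vs ! j = (if i = j then 1 else 0)" if "i < length vs" "j < length vs" for i j
  proof -
    have "(us @ vs) ! (length us + i) \<bullet> (us @ vs) ! (length us + j) = (if i = j then 1 else 0)"
      using that by (subst orthonormal_vecs_nth(2)[OF assms]) auto
    then show ?thesis by simp
  qed
  then show ?thesis using assms by (auto simp: orthonormal_vecs_def)
qed

lemma orthonormal_vecs_mat:
  assumes "orthonormal_vecs n us"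
  shows "(mat_of_cols n us)\<^sup>T * mat_of_cols n us = 1\<^sub>m (length us)"
proof (rule eq_matI)
  fix i j assume "i < dim_row (1\<^sub>m (length us) :: real mat)" "j < dim_col (1\<^sub>m (length us) :: real mat)"
  then have ij: "i < length us" "j < length us" by auto
  moreover have "us ! i \<in> carrier_vec n" "us ! j \<in> carrier_vec n"
    using assms ij unfolding orthonormal_vecs_def by auto
  ultimately show "((mat_of_cols n us)\<^sup>T * mat_of_cols n us) $$ (i, j) = 1\<^sub>m (length us) $$ (i, j)"
    using assms by (simp add: orthonormal_vecs_def)
qed auto

lemma orthonormal_vecs_cols:
  assumes "W \<in> carrier_mat n k" "W\<^sup>T * W = 1\<^sub>m k"
  shows "orthonormal_vecs n (cols W)"
proof -
  have "col W i \<bullet> col W j = (if i = j then 1 else 0)" if "i < k" "j < k" for i j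
  proof -
    have "col W i \<bullet> col W j = (W\<^sup>T * W) $$ (i, j)" using assms(1) that by simp
    then show ?thesis using that by (simp add: assms(2))
  qed
  then show ?thesis using assms(1) cols_dim[of W] by (simp add: orthonormal_vecs_def)
qed

lemma orthonormal_vecs_snoc:
  assumes "orthonormal_vecs n us" "v \<in> carrier_vec n" "v \<bullet> v = 1" "\<And>u. u \<in> set us \<Longrightarrow> u \<bullet> v = 0"
  shows "orthonormal_vecs n (us @ [v])"
proof -
  have "v \<bullet> u = 0" if "u \<in> set us" for u
    using assms that comm_scalar_prod[of u n v] unfolding orthonormal_vecs_def by auto
  then show ?thesis
    using assms by (auto simp: orthonormal_vecs_def nth_append less_Suc_eq)
qed

text \<open>As long as there are fewer than \<open>n\<close> vectors, the matrix having them as rows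
  is wide; a unit vector in its kernel is orthogonal to all of them.\<close>

lemma orthonormal_vecs_extend:
  assumes "orthonormal_vecs n us" "length us \<le> n"
  shows "\<exists>vs. orthonormal_vecs n (us @ vs) \<and> length (us @ vs) = n"
  using assms
proof (induction "n - length us" arbitrary: us)
  case 0
  then show ?case by (intro exI[of _ "[]"]) auto
next
  case (Suc d)
  let ?M = "mat_of_rows n us"
  have "?M \<in> carrier_mat (length us) n" "length us < n" using Suc by auto
  then obtain v where v: "v \<in> carrier_vec n" "?M *\<^sub>v v = 0\<^sub>v (length us)" "vec_norm2 v = 1"
    by (rule wide_matrix_kernel)
  have "us ! i \<bullet> v = 0" if "i < length us" for i
  proof -
    have "us ! i \<in> carrier_vec n" using Suc.prems that unfolding orthonormal_vecs_def by auto
    then have "us ! i \<bullet> v = (?M *\<^sub>v v) $ i" using that by simp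
    then show ?thesis using v(2) that by simp
  qed
  then have "u \<bullet> v = 0" if "u \<in> set us" for u using that by (metis in_set_conv_nth)
  moreover have "v \<bullet> v = 1" using vec_norm2_power2[of v] v(3) by simp
  ultimately have "orthonormal_vecs n (us @ [v])"
    using orthonormal_vecs_snoc Suc.prems(1) v(1) by blast
  moreover have "d = n - length (us @ [v])" "length (us @ [v]) \<le> n" using Suc by auto
  ultimately obtain vs where "orthonormal_vecs n ((us @ [v]) @ vs)" "length ((us @ [v]) @ vs) = n"
    using Suc.hyps(1) by blast
  then show ?case by (intro exI[of _ "v # vs"]) auto
qed

text \<open>Over the complex numbers an eigenvalue exists, and moving the real symmetric matrix
  across the Hermitian product of an eigenvector with itself shows that it equals its
  conjugate.\<close>

lemma symmetric_real_eigenvalue: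
  fixes A :: "real mat"
  assumes A: "A \<in> carrier_mat n n" and sym: "A\<^sup>T = A" and "0 < n"
  obtains v \<mu> where "v \<in> carrier_vec n" "vec_norm2 v = 1" "A *\<^sub>v v = \<mu> \<cdot>\<^sub>v v"
proof -
  let ?A = "map_mat complex_of_real A"
  have cA: "?A \<in> carrier_mat n n" using A by simp
  obtain z :: complex where z: "eigenvalue ?A z"
    using spectrum_non_empty[OF cA \<open>0 < n\<close>] by (auto simp: spectrum_def)
  then obtain w where "eigenvector ?A w z" unfolding eigenvalue_def by auto
  then have w: "w \<in> carrier_vec n" "w \<noteq> 0\<^sub>v n" "?A *\<^sub>v w = z \<cdot>\<^sub>v w"
    using A unfolding eigenvector_def by auto
  let ?w = "conjugate w"
  have cw: "?w \<in> carrier_vec n" using w(1) by simp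
  have cAw: "conjugate (?A *\<^sub>v w) = ?A *\<^sub>v ?w"
    using A w(1) by (intro eq_vecI) (auto simp: scalar_prod_def conjugate_complex_def)
  have "z * (w \<bullet> ?w) = (?A *\<^sub>v w) \<bullet> ?w" using w cw by simp
  also have "\<dots> = w \<bullet> (?A\<^sup>T *\<^sub>v ?w)"
  proof -
    have "w \<bullet> (?A\<^sup>T *\<^sub>v ?w) = (?A\<^sup>T *\<^sub>v ?w) \<bullet> w"
      using cA w(1) cw by (intro comm_scalar_prod[of _ n]) auto
    also have "\<dots> = ?w \<bullet> (?A *\<^sub>v w)" using cA w(1) cw by (intro transpose_vec_mult_scalar) auto
    also have "\<dots> = (?A *\<^sub>v w) \<bullet> ?w" using cA w(1) cw by (intro comm_scalar_prod[of _ n]) auto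
    finally show ?thesis by simp
  qed
  also have "?A\<^sup>T = ?A" using sym by (metis map_mat_transpose)
  also have "?A *\<^sub>v ?w = cnj z \<cdot>\<^sub>v ?w"
    using cAw w(3) by (simp add: conjugate_smult_vec conjugate_complex_def)
  also have "w \<bullet> (cnj z \<cdot>\<^sub>v ?w) = cnj z * (w \<bullet> ?w)" using w(1) cw by simp
  finally have "z = cnj z" using w(1,2) by simp
  then obtain \<mu> where \<mu>: "z = of_real \<mu>" by (metis Reals_cases Reals_cnj_iff)
  \<comment> \<open>The complex eigenvector \<open>w\<close> need not be real. The real root is
    therefore transferred to the real characteristic polynomial, which supplies a real
    eigenvector.\<close>
  have "poly (char_poly ?A) z = 0" using z eigenvalue_root_char_poly[OF cA] by simp
  then have "poly (char_poly A) \<mu> = 0"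
    by (simp add: \<mu> of_real_hom.char_poly_hom[OF A])
  then have "eigenvalue A \<mu>" using eigenvalue_root_char_poly[OF A] by simp
  then obtain v where "eigenvector A v \<mu>" unfolding eigenvalue_def by auto
  then have v: "v \<in> carrier_vec n" "v \<noteq> 0\<^sub>v n" "A *\<^sub>v v = \<mu> \<cdot>\<^sub>v v"
    using A unfolding eigenvector_def by auto
  let ?v = "(1 / vec_norm2 v) \<cdot>\<^sub>v v"
  have "A *\<^sub>v ?v = \<mu> \<cdot>\<^sub>v ?v"
    using A v by (simp add: mult_mat_vec[of A n n] smult_smult_assoc mult.commute)
  then show ?thesis
    using that[of ?v \<mu>] v(1) vec_norm2_normalize[OF v(1,2)] by simp
qed

text \<open>The full list forms a square matrix \<open>?W\<close>, so \<open>?W * ?W\<^sup>T\<close>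
  is the identity as well. In the resulting expansion of \<open>x\<close> the coordinates along
  \<open>us\<close> vanish.\<close>

lemma orthogonal_complement_decomp:
  fixes us vs :: "real vec list"
  assumes "orthonormal_vecs n (us @ vs)" "length (us @ vs) = n" "x \<in> carrier_vec n"
    "\<And>u. u \<in> set us \<Longrightarrow> u \<bullet> x = 0"
  shows "x = mat_of_cols n vs *\<^sub>v ((mat_of_cols n vs)\<^sup>T *\<^sub>v x)"
proof -
  let ?W = "mat_of_cols n (us @ vs)" and ?V = "mat_of_cols n vs"
  have W: "?W \<in> carrier_mat n n" using mat_of_cols_carrier(1)[of n "us @ vs"] assms(2) by simp
  have V: "?V \<in> carrier_mat n (length vs)" by simp
  have "?W\<^sup>T * ?W = 1\<^sub>m n" using orthonormal_vecs_mat[OF assms(1)] assms(2) by simp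
  then have inv: "?W * ?W\<^sup>T = 1\<^sub>m n" using W by (intro mat_mult_left_right_inverse[of "?W\<^sup>T" n]) auto
  have car: "us ! i \<in> carrier_vec n" if "i < length us" for i
    using assms(1) that unfolding orthonormal_vecs_def by auto
  have carv: "vs ! i \<in> carrier_vec n" if "i < length vs" for i
    using assms(1) that unfolding orthonormal_vecs_def by auto
  have Wx: "?W\<^sup>T *\<^sub>v x = 0\<^sub>v (length us) @\<^sub>v (?V\<^sup>T *\<^sub>v x)"
  proof (rule eq_vecI)
    fix i assume "i < dim_vec (0\<^sub>v (length us) @\<^sub>v (?V\<^sup>T *\<^sub>v x))"
    then have i: "i < length us + length vs" by simp
    have "(?W\<^sup>T *\<^sub>v x) $ i = (us @ vs) ! i \<bullet> x" 
      using i car[of i] carv[of "i - length us"] by (auto simp: nth_append)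
    also have "\<dots> = (0\<^sub>v (length us) @\<^sub>v (?V\<^sup>T *\<^sub>v x)) $ i"
      using i assms(4)[of "us ! i"] carv[of "i - length us"] by (auto simp: nth_append)
    finally show "(?W\<^sup>T *\<^sub>v x) $ i = (0\<^sub>v (length us) @\<^sub>v (?V\<^sup>T *\<^sub>v x)) $ i" .
  qed (use assms(2) in simp)
  have "x = (?W * ?W\<^sup>T) *\<^sub>v x" using inv assms(3) by simp
  also have "\<dots> = ?W *\<^sub>v (?W\<^sup>T *\<^sub>v x)" using W assms(3) by (intro assoc_mult_mat_vec) auto
  also have "\<dots> = ?V *\<^sub>v (?V\<^sup>T *\<^sub>v x)"
  proof (rule eq_vecI)
    fix i assume "i < dim_vec (?V *\<^sub>v (?V\<^sup>T *\<^sub>v x))"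
    then have i: "i < n" by simp
    have rw: "row ?W i = row (mat_of_cols n us) i @\<^sub>v row ?V i"
      using i by (intro eq_vecI) (auto simp: mat_of_cols_index nth_append)
    have "(?W *\<^sub>v (?W\<^sup>T *\<^sub>v x)) $ i = row ?W i \<bullet> (0\<^sub>v (length us) @\<^sub>v (?V\<^sup>T *\<^sub>v x))"
      using i unfolding Wx by simp
    also have "\<dots> = row (mat_of_cols n us) i \<bullet> 0\<^sub>v (length us) + row ?V i \<bullet> (?V\<^sup>T *\<^sub>v x)"
      unfolding rw using assms(3)
      by (intro scalar_prod_append mult_mat_vec_carrier[of _ _ n]) (auto simp: row_def)
    also have "row (mat_of_cols n us) i \<bullet> 0\<^sub>v (length us) = 0"
      by (intro scalar_prod_right_zero) (auto simp: row_def)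
    finally show "(?W *\<^sub>v (?W\<^sup>T *\<^sub>v x)) $ i = (?V *\<^sub>v (?V\<^sup>T *\<^sub>v x)) $ i" using i by simp
  qed simp
  finally show ?thesis .
qed

lemma mult_mat_vec_mat_of_cols_orthogonal:
  fixes us vs :: "real vec list"
  assumes "orthonormal_vecs n (us @ vs)" "z \<in> carrier_vec (length vs)" "u \<in> set us"
  shows "u \<bullet> (mat_of_cols n vs *\<^sub>v z) = 0"
proof -
  let ?V = "mat_of_cols n vs"
  have u: "u \<in> carrier_vec n" using assms unfolding orthonormal_vecs_def by auto
  have "(?V\<^sup>T *\<^sub>v u) $ i = 0" if i: "i < length vs" for i
  proof -
    have vi: "vs ! i \<in> carrier_vec n" using assms(1) i unfolding orthonormal_vecs_def by auto
    obtain j where j: "j < length us" "u = us ! j" using assms(3) by (metis in_set_conv_nth)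
    have "(us @ vs) ! (length us + i) \<bullet> (us @ vs) ! j = (if length us + i = j then 1 else 0)"
      using assms(1) i j unfolding orthonormal_vecs_def by (simp del: nth_append_length_plus)
    then have "vs ! i \<bullet> u = 0" using j by (simp add: nth_append)
    then show ?thesis using i vi by simp
  qed
  then have "?V\<^sup>T *\<^sub>v u = 0\<^sub>v (length vs)" by (intro eq_vecI) auto
  moreover have "u \<bullet> (?V *\<^sub>v z) = (?V *\<^sub>v z) \<bullet> u" 
    using u assms(2) by (intro comm_scalar_prod[of _ n] mult_mat_vec_carrier[of _ _ "length vs"]) auto
  moreover have "(?V *\<^sub>v z) \<bullet> u = z \<bullet> (?V\<^sup>T *\<^sub>v u)"
    using u assms(2) by (intro scalar_prod_mult_mat_vec) auto
  ultimately show ?thesis using assms(2) by simp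
qed

lemma congruence_symmetric:
  fixes A :: "real mat"
  assumes A: "A \<in> carrier_mat n n" and sym: "A\<^sup>T = A" and M: "M \<in> carrier_mat n k"
  shows "(M\<^sup>T * A * M)\<^sup>T = M\<^sup>T * A * M"
proof -
  have MA: "M\<^sup>T * A \<in> carrier_mat k n" using A M by auto
  have "(M\<^sup>T * A * M)\<^sup>T = M\<^sup>T * (M\<^sup>T * A)\<^sup>T" using transpose_mult[OF MA M] .
  also have "(M\<^sup>T * A)\<^sup>T = A * M" using transpose_mult[of "M\<^sup>T" k n A n] A M sym by simp
  also have "M\<^sup>T * (A * M) = M\<^sup>T * A * M" using A M by (intro assoc_mult_mat[symmetric]) auto
  finally show ?thesis .
qed

lemma congruence_mult_mat_vec:
  fixes A :: "real mat"
  assumes A: "A \<in> carrier_mat n n" and M: "M \<in> carrier_mat n k" and y: "y \<in> carrier_vec k"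
  shows "M\<^sup>T * A * M *\<^sub>v y = M\<^sup>T *\<^sub>v (A *\<^sub>v (M *\<^sub>v y))"
proof -
  have MT: "M\<^sup>T \<in> carrier_mat k n" using M by simp
  have Mv: "M *\<^sub>v y \<in> carrier_vec n" by (rule mult_mat_vec_carrier[OF M y])
  have "M\<^sup>T * A * M *\<^sub>v y = M\<^sup>T * A *\<^sub>v (M *\<^sub>v y)"
    by (rule assoc_mult_mat_vec[OF mult_carrier_mat[OF MT A] M y])
  also have "\<dots> = M\<^sup>T *\<^sub>v (A *\<^sub>v (M *\<^sub>v y))" by (rule assoc_mult_mat_vec[OF MT A Mv])
  finally show ?thesis .
qed

text \<open>Deflation: compress \<open>A\<close> to the orthogonal complement of the eigenvectors
  found so far, take an eigenvector of the symmetric compression and lift it.\<close>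

lemma symmetric_eigenvector_list:
  fixes A :: "real mat"
  assumes A: "A \<in> carrier_mat n n" and sym: "A\<^sup>T = A" and "m \<le> n"
  shows "\<exists>us. orthonormal_vecs n us \<and> length us = m \<and> (\<forall>u\<in>set us. \<exists>\<mu>. A *\<^sub>v u = \<mu> \<cdot>\<^sub>v u)"
  using \<open>m \<le> n\<close>
proof (induction m)
  case 0
  then show ?case by (intro exI[of _ "[]"]) (auto simp: orthonormal_vecs_def)
next
  case (Suc m)
  then obtain us where us: "orthonormal_vecs n us" "length us = m" "\<And>u. u \<in> set us \<Longrightarrow> \<exists>\<mu>. A *\<^sub>v u = \<mu> \<cdot>\<^sub>v u"
    by auto
  obtain vs where vs: "orthonormal_vecs n (us @ vs)" "length (us @ vs) = n"
    using orthonormal_vecs_extend[OF us(1)] us(2) Suc.prems by auto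
  let ?V = "mat_of_cols n vs"
  let ?k = "length vs"
  have V: "?V \<in> carrier_mat n ?k" by simp
  have VT: "?V\<^sup>T \<in> carrier_mat ?k n" by simp
  have k: "0 < ?k" using vs(2) us(2) Suc.prems by (cases vs) auto
  have VV: "?V\<^sup>T * ?V = 1\<^sub>m ?k"
    by (rule orthonormal_vecs_mat[OF orthonormal_vecs_appendD2[OF vs(1)]])
  let ?D = "?V\<^sup>T * A * ?V"
  have D: "?D \<in> carrier_mat ?k ?k" using V A by (metis VT mult_carrier_mat)
  have "?D\<^sup>T = ?D"
    using congruence_symmetric[OF A sym V] .
  then obtain z \<mu> where z: "z \<in> carrier_vec ?k" "vec_norm2 z = 1" "?D *\<^sub>v z = \<mu> \<cdot>\<^sub>v z"
    using symmetric_real_eigenvalue[OF D _ k] by blast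
  let ?x = "?V *\<^sub>v z"
  have x: "?x \<in> carrier_vec n" by (rule mult_mat_vec_carrier[OF V z(1)])
  have nx: "?x \<bullet> ?x = 1"
    using scalar_prod_isometry[OF V VV z(1) z(1)] vec_norm2_power2[of z] z(2) by simp
  have ux: "u \<bullet> ?x = 0" if "u \<in> set us" for u
    using mult_mat_vec_mat_of_cols_orthogonal[OF vs(1) z(1) that] .
  \<comment> \<open>By symmetry of \<open>A\<close> the complement is invariant. Hence projecting
    \<open>A *\<^sub>v ?x\<close> back onto it loses nothing, and an eigenvector of the compression
    is one of \<open>A\<close>.\<close>
  have "u \<bullet> (A *\<^sub>v ?x) = 0" if "u \<in> set us" for u
  proof -
    have u: "u \<in> carrier_vec n" using us(1) that unfolding orthonormal_vecs_def by auto
    obtain c where c: "A *\<^sub>v u = c \<cdot>\<^sub>v u" using us(3) \<open>u \<in> set us\<close> by auto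
    have "u \<bullet> (A *\<^sub>v ?x) = (A *\<^sub>v u) \<bullet> ?x"
      using scalar_prod_mult_mat_vec[OF A u x] sym by simp
    also have "\<dots> = c * (u \<bullet> ?x)" using u x c by simp
    finally show ?thesis using ux[OF that] by simp
  qed
  then have "A *\<^sub>v ?x = ?V *\<^sub>v (?V\<^sup>T *\<^sub>v (A *\<^sub>v ?x))"
    using orthogonal_complement_decomp[OF vs] A x by auto
  also have "?V\<^sup>T *\<^sub>v (A *\<^sub>v ?x) = ?D *\<^sub>v z"
    by (rule congruence_mult_mat_vec[OF A V z(1), symmetric])
  also have "?V *\<^sub>v (?D *\<^sub>v z) = \<mu> \<cdot>\<^sub>v ?x" unfolding z(3) using V z(1) by (rule mult_mat_vec)
  finally have "A *\<^sub>v ?x = \<mu> \<cdot>\<^sub>v ?x" .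
  then show ?case
    using orthonormal_vecs_snoc[OF us(1) x nx ux] us(2,3) by (intro exI[of _ "us @ [?x]"]) auto
qed

lemma symmetric_diagonalization:
  fixes A :: "real mat"
  assumes A: "A \<in> carrier_mat n n" and sym: "A\<^sup>T = A"
  obtains U d where "U \<in> carrier_mat n n" "U\<^sup>T * U = 1\<^sub>m n" "U * U\<^sup>T = 1\<^sub>m n" "A = U * mat_diag n d * U\<^sup>T"
proof -
  obtain us where us: "orthonormal_vecs n us" "length us = n" "\<And>u. u \<in> set us \<Longrightarrow> \<exists>\<mu>. A *\<^sub>v u = \<mu> \<cdot>\<^sub>v u"
    using symmetric_eigenvector_list[OF assms, of n] by auto
  define U where "U = mat_of_cols n us"
  have U: "U \<in> carrier_mat n n" unfolding U_def using us(2) mat_of_cols_carrier(1)[of n us] by simp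
  have UU: "U\<^sup>T * U = 1\<^sub>m n" using orthonormal_vecs_mat[OF us(1)] us(2) by (simp add: U_def)
  have UU': "U * U\<^sup>T = 1\<^sub>m n" using UU U by (intro mat_mult_left_right_inverse[of "U\<^sup>T" n]) auto
  have "\<forall>i. \<exists>\<mu>. i < n \<longrightarrow> A *\<^sub>v (us ! i) = \<mu> \<cdot>\<^sub>v (us ! i)" using us(2,3) by auto
  then obtain d where d: "\<And>i. i < n \<Longrightarrow> A *\<^sub>v (us ! i) = d i \<cdot>\<^sub>v (us ! i)" by metis
  have "A * U = U * mat_diag n d"
  proof (rule eq_matI)
    fix i j assume "i < dim_row (U * mat_diag n d)" "j < dim_col (U * mat_diag n d)"
    then have ij: "i < n" "j < n" using U by (auto simp: mat_diag_def)
    have c: "col U j = us ! j" "us ! j \<in> carrier_vec n"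
      using ij us(2) orthonormal_vecs_nth(1)[OF us(1), of j] by (auto simp: U_def)
    have "(A * U) $$ (i, j) = (A *\<^sub>v (us ! j)) $ i" using A U ij c by simp
    also have "\<dots> = d j * us ! j $ i" using d[OF ij(2)] c(2) ij(1) by simp
    also have "us ! j $ i = U $$ (i, j)" using ij us(2) by (simp add: U_def mat_of_cols_index)
    finally show "(A * U) $$ (i, j) = (U * mat_diag n d) $$ (i, j)"
      using U ij by (simp add: mat_diag_mult_right[OF U] mult.commute)
  qed (use A U in \<open>auto simp: mat_diag_def\<close>)
  then have "U * mat_diag n d * U\<^sup>T = A * U * U\<^sup>T" by simp
  also have "\<dots> = A" using A U UU' by (simp add: assoc_mult_mat[of _ n n _ n _ n])
  finally show ?thesis using that U UU UU' by metis
qed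

section \<open>Ritz values of the leading invariant subspace\<close>

lemma mat_diag_mult_vec:
  fixes x :: "real vec"
  assumes "x \<in> carrier_vec n"
  shows "mat_diag n d *\<^sub>v x = vec n (\<lambda>i. d i * x $ i)"
proof (rule eq_vecI)
  fix i assume "i < dim_vec (vec n (\<lambda>i. d i * x $ i))"
  then have i: "i < n" by simp
  have "row (mat_diag n d) i = d i \<cdot>\<^sub>v unit_vec n i" using i by (intro eq_vecI) (auto simp: mat_diag_def)
  moreover have "(d i \<cdot>\<^sub>v unit_vec n i) \<bullet> x = d i * x $ i"
    using i assms by (subst smult_scalar_prod_distrib[of _ n]) auto
  ultimately have "(mat_diag n d *\<^sub>v x) $ i = d i * x $ i" using i by (simp add: mat_diag_def)
  then show "(mat_diag n d *\<^sub>v x) $ i = vec n (\<lambda>i. d i * x $ i) $ i" using i by simp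
qed (simp add: mat_diag_def)

lemma mat_diag_quadratic_form:
  fixes x :: "real vec"
  assumes "x \<in> carrier_vec n"
  shows "x \<bullet> (mat_diag n d *\<^sub>v x) = (\<Sum>i<n. d i * (x $ i)\<^sup>2)"
  using assms
  by (simp add: mat_diag_mult_vec scalar_prod_def power2_eq_square atLeast0LessThan mult.left_commute)

lemma conjugated_diag_mult_vec:
  fixes U :: "real mat"
  assumes "U \<in> carrier_mat n n" "x \<in> carrier_vec n"
  shows "U * mat_diag n d * U\<^sup>T *\<^sub>v x = U *\<^sub>v (mat_diag n d *\<^sub>v (U\<^sup>T *\<^sub>v x))"
  using congruence_mult_mat_vec[OF mat_diag_dim[of n d], of "U\<^sup>T" n x] assms by simp

lemma quadratic_form_diagonalization:
  fixes U :: "real mat"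
  assumes U: "U \<in> carrier_mat n n" and x: "x \<in> carrier_vec n" and A: "A = U * mat_diag n d * U\<^sup>T"
  shows "x \<bullet> (A *\<^sub>v x) = (\<Sum>i<n. d i * ((U\<^sup>T *\<^sub>v x) $ i)\<^sup>2)"
proof -
  let ?z = "U\<^sup>T *\<^sub>v x" and ?D = "mat_diag n d"
  have UT: "U\<^sup>T \<in> carrier_mat n n" using U by simp
  have z: "?z \<in> carrier_vec n" by (rule mult_mat_vec_carrier[OF UT x])
  have Dz: "?D *\<^sub>v ?z \<in> carrier_vec n" by (rule mult_mat_vec_carrier[OF mat_diag_dim z])
  have "?z \<bullet> (?D *\<^sub>v ?z) = x \<bullet> (U *\<^sub>v (?D *\<^sub>v ?z))"
    using scalar_prod_mult_mat_vec[OF UT x Dz] by simp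
  then have "x \<bullet> (A *\<^sub>v x) = ?z \<bullet> (?D *\<^sub>v ?z)"
    unfolding A conjugated_diag_mult_vec[OF U x] by simp
  then show ?thesis using mat_diag_quadratic_form[OF z] by simp
qed

lemma char_poly_similar_orthogonal:
  fixes U :: "real mat"
  assumes U: "U \<in> carrier_mat n n" "U\<^sup>T * U = 1\<^sub>m n" and M: "M \<in> carrier_mat n n"
  shows "char_poly (U\<^sup>T * M * U) = char_poly M"
proof -
  have "U * U\<^sup>T = 1\<^sub>m n" using U by (intro mat_mult_left_right_inverse[of "U\<^sup>T" n]) auto
  then have "similar_mat_wit (U\<^sup>T * M * U) M (U\<^sup>T) U"
    using U M by (intro similar_mat_witI[of _ _ n]) auto
  then show ?thesis by (intro char_poly_similar) (auto simp: similar_mat_def)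
qed

lemma char_poly_diag:
  fixes D :: "real mat"
  assumes "D \<in> carrier_mat n n" "diagonal_mat D"
  shows "char_poly D = (\<Prod>a\<leftarrow>diag_mat D. [:- a, 1:])"
  using assms by (intro char_poly_upper_triangular[of _ n]) (auto simp: diagonal_mat_def upper_triangular_def)

lemma poly_prod_list_linear_eq_0:
  "poly (\<Prod>a\<leftarrow>as. [:- a, 1:]) (x :: real) = 0 \<longleftrightarrow> x \<in> set as"
  by (induction as) auto

lemma index_congruence:
  assumes "X \<in> carrier_mat n k" "M \<in> carrier_mat n n" "Y \<in> carrier_mat n l" "i < k" "j < l"
  shows "(X\<^sup>T * M * Y) $$ (i, j) = col X i \<bullet> (M *\<^sub>v col Y j)"
proof -
  have "X\<^sup>T * M * Y = X\<^sup>T * (M * Y)" using assms by (intro assoc_mult_mat) auto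
  moreover have "col (M * Y) j = M *\<^sub>v col Y j" by (rule col_mult2[OF assms(2,3,5)])
  ultimately show ?thesis using assms by simp
qed

lemma mult_eq_0_orthonormal_append:
  assumes "orthonormal_vecs n (us @ vs)"
  shows "(mat_of_cols n vs)\<^sup>T * mat_of_cols n us = 0\<^sub>m (length vs) (length us)"
proof (rule eq_matI)
  fix i j assume "i < dim_row (0\<^sub>m (length vs) (length us) :: real mat)" "j < dim_col (0\<^sub>m (length vs) (length us) :: real mat)"
  then have ij: "i < length vs" "j < length us" by auto
  have c: "vs ! i \<in> carrier_vec n" "us ! j \<in> carrier_vec n"
    using ij orthonormal_vecs_nth(1)[OF assms, of "length us + i"] orthonormal_vecs_nth(1)[OF assms, of j]
    by (auto simp: nth_append)
  have "vs ! i \<bullet> us ! j = 0"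
    using ij orthonormal_vecs_nth(2)[OF assms, of "length us + i" j] by (simp add: nth_append)
  then show "((mat_of_cols n vs)\<^sup>T * mat_of_cols n us) $$ (i, j) = 0\<^sub>m (length vs) (length us) $$ (i, j)"
    using ij c by simp
qed auto

text \<open>The predicate speaks of some basis \<open>B\<close> with representing matrix
  \<open>T\<close>. Both \<open>S\<close> and \<open>T\<close> represent the restriction of
  \<open>M\<close> to the same subspace, so the change of basis \<open>G\<close> makes them
  similar.\<close>

lemma leading_char_poly:
  fixes Q S M :: "real mat"
  assumes Q: "Q \<in> carrier_mat n r" "Q\<^sup>T * Q = 1\<^sub>m r" and M: "M \<in> carrier_mat n n"
    and S: "S \<in> carrier_mat r r" and MQ: "M * Q = Q * S"
    and leading: "leading_invariant_subspace r M (mat_range Q)"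
  obtains es where "length es = n" "sorted_wrt (\<ge>) es" "char_poly M = (\<Prod>e\<leftarrow>es. [:- e, 1:])"
    "char_poly S = (\<Prod>e\<leftarrow>take r es. [:- e, 1:])"
proof -
  obtain es B T where es: "length es = n" "sorted_wrt (\<ge>) es" "char_poly M = (\<Prod>e\<leftarrow>es. [:- e, 1:])"
    and B: "B \<in> carrier_mat n r" and T: "T \<in> carrier_mat r r" and ker: "mat_kernel B = {0\<^sub>v r}"
    and rng: "mat_range Q = mat_range B" and MB: "M * B = B * T"
    and cT: "char_poly T = (\<Prod>e\<leftarrow>take r es. [:- e, 1:])"
    using leading M unfolding leading_invariant_subspace_def by auto
  define G where "G = Q\<^sup>T * B"
  have G: "G \<in> carrier_mat r r" using Q B by (simp add: G_def)
  have B_eq: "B = Q * G"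
  proof (rule mat_col_eqI)
    fix j assume "j < dim_col (Q * G)"
    then have j: "j < r" using G by simp
    \<comment> \<open>Columns of \<open>B\<close> lie in the range of \<open>Q\<close>, on which
      \<open>Q * Q\<^sup>T\<close> acts as the identity.\<close>
    have "col B j = B *\<^sub>v unit_vec r j" using B j by (intro eq_vecI) auto
    then have "col B j \<in> mat_range B" using B j unfolding mat_range_def by auto
    then obtain x where x: "x \<in> carrier_vec r" "col B j = Q *\<^sub>v x"
      using rng Q unfolding mat_range_def by auto
    have "col (Q * G) j = Q *\<^sub>v (Q\<^sup>T *\<^sub>v col B j)"
      using col_mult2[OF Q(1) G j] col_mult2[of "Q\<^sup>T" r n B r j] Q(1) B j by (simp add: G_def)
    also have "Q\<^sup>T *\<^sub>v (Q *\<^sub>v x) = x"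
      using Q x by (simp add: assoc_mult_mat_vec[of "Q\<^sup>T" r n Q r, symmetric] del: assoc_mult_mat_vec)
    then have "Q *\<^sub>v (Q\<^sup>T *\<^sub>v col B j) = col B j" unfolding x(2) by simp
    finally show "col B j = col (Q * G) j" by simp
  qed (use B Q G in auto)
  have "Q * (S * G) = Q * (G * T)"
  proof -
    have "Q * (S * G) = M * Q * G" using Q S G MQ by (simp add: assoc_mult_mat[of Q n r S r G r])
    also have "\<dots> = M * B" using M Q G by (simp add: B_eq assoc_mult_mat[of M n n Q r G r])
    also have "\<dots> = Q * G * T" using MB B_eq by simp
    also have "\<dots> = Q * (G * T)" using Q G T by (intro assoc_mult_mat) auto
    finally show ?thesis .
  qed
  moreover have "Q\<^sup>T * (Q * X) = X" if "X \<in> carrier_mat r r" for X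
    using assoc_mult_mat[of "Q\<^sup>T" r n Q r X r] Q that by simp
  ultimately have SG: "S * G = G * T" using S G T by (metis mult_carrier_mat)
  have "det G \<noteq> 0"
  proof
    assume "det G = 0"
    then obtain v where v: "v \<in> carrier_vec r" "v \<noteq> 0\<^sub>v r" "G *\<^sub>v v = 0\<^sub>v r"
      using det_0_iff_vec_prod_zero[OF G] by auto
    have "B *\<^sub>v v = 0\<^sub>v n" using Q G v by (auto simp: B_eq assoc_mult_mat_vec[of Q n r G r])
    then have "v \<in> mat_kernel B" using B v(1) unfolding mat_kernel_def by auto
    then show False using ker v(2) by simp
  qed
  then obtain H where H: "H \<in> carrier_mat r r" "G * H = 1\<^sub>m r" "H * G = 1\<^sub>m r"
    using det_non_zero_imp_unit[OF G, of "()"] unfolding Units_def ring_mat_def by auto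
  have "S = G * T * H"
  proof -
    have "G * T * H = S * (G * H)" using S G H SG[symmetric] by (simp add: assoc_mult_mat[of S r r G r H r])
    then show ?thesis using H S by simp
  qed
  then have "similar_mat_wit S T G H"
    using S T G H by (intro similar_mat_witI[of _ _ r]) auto
  then have "char_poly S = char_poly T" by (intro char_poly_similar) (auto simp: similar_mat_def)
  then show ?thesis using that es cT by simp
qed

text \<open>\<open>M\<close> is block triangular in an orthonormal basis extending the columns of \<open>Q\<close>, and
  its lower right block is the symmetric compression of \<open>A\<close>.\<close>

lemma leading_rayleigh_le:
  fixes A Q S E :: "real mat"
  assumes A: "A \<in> carrier_mat n n" "A\<^sup>T = A" and Q: "Q \<in> carrier_mat n r" "Q\<^sup>T * Q = 1\<^sub>m r"
    and S: "S \<in> carrier_mat r r" "diagonal_mat S" and E: "E \<in> carrier_mat n r" and rn: "r \<le> n"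
    and residual: "A * Q - Q * S = E"
    and leading: "leading_invariant_subspace r (A - E * Q\<^sup>T) (mat_range Q)"
    and w: "w \<in> carrier_vec n" "\<And>i. i < r \<Longrightarrow> col Q i \<bullet> w = 0" and j: "j < r"
  shows "w \<bullet> (A *\<^sub>v w) \<le> S $$ (j, j) * (w \<bullet> w)"
proof -
  define M where "M = A - E * Q\<^sup>T"
  have M: "M \<in> carrier_mat n n" using A E Q by (simp add: M_def minus_carrier_mat)
  have EQT: "E * Q\<^sup>T \<in> carrier_mat n n" using E Q by simp
  have MX: "M * X = A * X - E * (Q\<^sup>T * X)" if "X \<in> carrier_mat n k" for X k
    using minus_mult_distrib_mat[OF A(1) EQT that] that E Q
    by (simp add: M_def assoc_mult_mat[of E n r "Q\<^sup>T" n X k])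
  have "M * Q = A * Q - E" using MX[OF Q(1)] Q E by simp
  also have "\<dots> = Q * S"
  proof (rule eq_matI)
    fix i j assume ij: "i < dim_row (Q * S)" "j < dim_col (Q * S)"
    have "E $$ (i, j) = (A * Q - Q * S) $$ (i, j)" using residual by simp
    also have "\<dots> = (A * Q) $$ (i, j) - (Q * S) $$ (i, j)" using ij by (rule index_minus_mat)
    finally show "(A * Q - E) $$ (i, j) = (Q * S) $$ (i, j)"
      using ij E Q S by simp
  qed (use E Q S in auto)
  finally have MQ: "M * Q = Q * S" .
  obtain es where es: "length es = n" "sorted_wrt (\<ge>) es" "char_poly M = (\<Prod>e\<leftarrow>es. [:- e, 1:])"
    and cS: "char_poly S = (\<Prod>e\<leftarrow>take r es. [:- e, 1:])"
    using leading_char_poly[OF Q M S(1) MQ leading[folded M_def]] .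
  let ?us = "cols Q"
  have lus: "length ?us = r" using Q by simp
  obtain vs where vs: "orthonormal_vecs n (?us @ vs)" "length (?us @ vs) = n"
    using orthonormal_vecs_extend[OF orthonormal_vecs_cols[OF Q]] rn lus by auto
  define k where "k = length vs"
  define V where "V = mat_of_cols n vs"
  have V: "V \<in> carrier_mat n k" unfolding V_def k_def by simp
  have VV: "V\<^sup>T * V = 1\<^sub>m k"
    unfolding V_def k_def by (rule orthonormal_vecs_mat[OF orthonormal_vecs_appendD2[OF vs(1)]])
  have Qc: "mat_of_cols n ?us = Q" using Q by (metis mat_of_cols_cols carrier_matD(1))
  have VQ: "V\<^sup>T * Q = 0\<^sub>m k r"
    using mult_eq_0_orthonormal_append[OF vs(1)] Q by (simp add: V_def k_def Qc)
  then have QV: "Q\<^sup>T * V = 0\<^sub>m r k"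
    using transpose_mult[of "V\<^sup>T" k n Q r] V Q by (simp add: zero_transpose_mat)
  define D where "D = V\<^sup>T * A * V"
  have D: "D \<in> carrier_mat k k" using V A by (simp add: D_def)
  obtain U d where U: "U \<in> carrier_mat k k" "U\<^sup>T * U = 1\<^sub>m k" "U * U\<^sup>T = 1\<^sub>m k" and DU: "D = U * mat_diag k d * U\<^sup>T"
    using symmetric_diagonalization[OF D congruence_symmetric[OF A V, folded D_def]] .
  let ?dd = "mat_diag k d"
  have dd: "?dd \<in> carrier_mat k k" by simp
  have "diagonal_mat ?dd" by (auto simp: diagonal_mat_def mat_diag_def)
  moreover have "diag_mat ?dd = map d [0..<k]" by (rule nth_equalityI) (auto simp: diag_mat_def mat_diag_def)
  ultimately have cdd: "char_poly ?dd = (\<Prod>a\<leftarrow>map d [0..<k]. [:- a, 1:])"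
    using char_poly_diag[OF dd] by simp
  have cD: "char_poly D = (\<Prod>a\<leftarrow>map d [0..<k]. [:- a, 1:])"
    using char_poly_similar_orthogonal[of "U\<^sup>T" k ?dd] U DU dd cdd by simp
  define P where "P = mat_of_cols n (?us @ vs)"
  have P: "P \<in> carrier_mat n n" unfolding P_def using mat_of_cols_carrier(1)[of n "?us @ vs"] vs(2) by simp
  have PP: "P\<^sup>T * P = 1\<^sub>m n" unfolding P_def using orthonormal_vecs_mat[OF vs(1)] vs(2) by simp
  have n: "n = r + k" using vs(2) lus by (simp add: k_def)
  have colP: "col P i = (if i < r then col Q i else col V (i - r))" if "i < n" for i
  proof -
    have car: "(?us @ vs) ! i \<in> carrier_vec n" using orthonormal_vecs_nth(1)[OF vs(1)] vs(2) that by simp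
    then have "col P i = (?us @ vs) ! i" unfolding P_def using that vs(2) by (intro col_mat_of_cols) auto
    then show ?thesis
      using that car lus n Q by (auto simp: nth_append V_def k_def)
  qed
  have MVQ: "V\<^sup>T * M * Q = 0\<^sub>m k r" and MQQ: "Q\<^sup>T * M * Q = S"
  proof -
    have "V\<^sup>T * M * Q = V\<^sup>T * Q * S" using V M Q S MQ
      by (simp add: assoc_mult_mat[of "V\<^sup>T" k n M n Q r] assoc_mult_mat[of "V\<^sup>T" k n Q r S r])
    then show "V\<^sup>T * M * Q = 0\<^sub>m k r" using VQ S by simp
    have "Q\<^sup>T * M * Q = Q\<^sup>T * Q * S" using M Q(1) S MQ
      by (simp add: assoc_mult_mat[of "Q\<^sup>T" r n M n Q r] assoc_mult_mat[of "Q\<^sup>T" r n Q r S r])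
    then show "Q\<^sup>T * M * Q = S" using Q S by simp
  qed
  have MVV: "V\<^sup>T * M * V = D"
  proof -
    \<comment> \<open>The correction \<open>E * Q\<^sup>T\<close> annihilates the complement of the
      columns of \<open>Q\<close>, so this block is symmetric although \<open>M\<close> is
      not.\<close>
    have "M * V = A * V" using MX[OF V] QV E A V by (auto simp: right_mult_zero_mat[of E n r k])
    then show ?thesis using V M A by (simp add: D_def assoc_mult_mat[of "V\<^sup>T" k n _ n V k])
  qed
  have blk: "P\<^sup>T * M * P = four_block_mat S (Q\<^sup>T * M * V) (0\<^sub>m k r) D"
  proof (rule eq_matI)
    fix i j assume "i < dim_row (four_block_mat S (Q\<^sup>T * M * V) (0\<^sub>m k r) D)"
      "j < dim_col (four_block_mat S (Q\<^sup>T * M * V) (0\<^sub>m k r) D)"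
    then have ij: "i < n" "j < n" using S D n by auto
    have e: "(P\<^sup>T * M * P) $$ (i, j) = col P i \<bullet> (M *\<^sub>v col P j)"
      by (rule index_congruence[OF P M P ij])
    have f: "four_block_mat S (Q\<^sup>T * M * V) (0\<^sub>m k r) D $$ (i, j) =
      (if i < r then if j < r then S $$ (i, j) else (Q\<^sup>T * M * V) $$ (i, j - r)
       else if j < r then 0\<^sub>m k r $$ (i - r, j) else D $$ (i - r, j - r))"
      using ij S D n by (subst index_mat_four_block) auto
    show "(P\<^sup>T * M * P) $$ (i, j) = four_block_mat S (Q\<^sup>T * M * V) (0\<^sub>m k r) D $$ (i, j)"
      unfolding e f using ij n
        index_congruence[OF Q(1) M Q(1), of i j] index_congruence[OF Q(1) M V, of i "j - r"]
        index_congruence[OF V M Q(1), of "i - r" j] index_congruence[OF V M V, of "i - r" "j - r"]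
      by (auto simp: colP MVQ MQQ MVV)
  qed (use P S D n in auto)
  have "char_poly M = char_poly S * char_poly D"
  proof -
    have "\<exists>es. char_poly S = (\<Prod>a\<leftarrow>es. [:- a, 1:])" "\<exists>es. char_poly D = (\<Prod>a\<leftarrow>es. [:- a, 1:])"
      using cS cD by blast+
    moreover have "Q\<^sup>T * M * V \<in> carrier_mat r k" using Q M V by simp
    ultimately show ?thesis
      using char_poly_0_block[OF blk _ _ S(1) _ D] char_poly_similar_orthogonal[OF P PP M] by simp
  qed
  moreover have "(\<Prod>e\<leftarrow>es. [:- e, 1:]) = (\<Prod>e\<leftarrow>take r es. [:- e, 1:]) * (\<Prod>e\<leftarrow>drop r es. [:- e, 1:])"
    by (metis append_take_drop_id map_append prod_list.append)
  \<comment> \<open>Cancelling the common factor \<open>char_poly S\<close> leaves exactly the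
    trailing eigenvalues for the compression \<open>D\<close>.\<close>
  moreover have "(\<Prod>e\<leftarrow>take r es. [:- e, 1:]) \<noteq> 0" by (auto simp: prod_list_zero_iff)
  ultimately have cDes: "char_poly D = (\<Prod>e\<leftarrow>drop r es. [:- e, 1:])" using es(3) cS by auto
  \<comment> \<open>Here the subspace being leading is used: eigenvalues of \<open>D\<close> sit in
    \<open>drop r es\<close>, diagonal entries of \<open>S\<close> in \<open>take r es\<close>, and
    \<open>es\<close> is nonincreasing. No order among the entries of \<open>S\<close> is involved,
    so every \<open>j\<close> is covered.\<close>
  have le: "d i \<le> S $$ (j, j)" if "i < k" for i
  proof -
    have "poly (char_poly D) (d i) = 0" unfolding cD poly_prod_list_linear_eq_0 using that by auto
    then have "d i \<in> set (drop r es)" unfolding cDes poly_prod_list_linear_eq_0 .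
    moreover have "S $$ (j, j) \<in> set (diag_mat S)" using j S by (auto simp: diag_mat_def)
    then have "poly (char_poly S) (S $$ (j, j)) = 0"
      unfolding char_poly_diag[OF S] poly_prod_list_linear_eq_0 .
    then have "S $$ (j, j) \<in> set (take r es)" unfolding cS poly_prod_list_linear_eq_0 .
    moreover have "sorted_wrt (\<ge>) (take r es @ drop r es)" using es(2) by simp
    ultimately show ?thesis unfolding sorted_wrt_append by auto
  qed
  define y where "y = V\<^sup>T *\<^sub>v w"
  have y: "y \<in> carrier_vec k" using V w by (auto simp: y_def)
  have wy: "w = V *\<^sub>v y"
    unfolding y_def V_def
  proof (rule orthogonal_complement_decomp[OF vs w(1)])
    fix u assume "u \<in> set ?us"
    then obtain i where "i < r" "u = col Q i" using Q by (auto simp: cols_def)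
    then show "u \<bullet> w = 0" using w(2) by simp
  qed
  let ?z = "U\<^sup>T *\<^sub>v y"
  have "w \<bullet> (A *\<^sub>v w) = y \<bullet> (D *\<^sub>v y)"
  proof -
    have "w \<bullet> (A *\<^sub>v w) = y \<bullet> (V\<^sup>T *\<^sub>v (A *\<^sub>v (V *\<^sub>v y)))"
      using scalar_prod_mult_mat_vec[OF V y, of "A *\<^sub>v (V *\<^sub>v y)"] A V y w(1) by (simp add: wy)
    also have "V\<^sup>T *\<^sub>v (A *\<^sub>v (V *\<^sub>v y)) = D *\<^sub>v y"
      unfolding D_def by (rule congruence_mult_mat_vec[OF A(1) V y, symmetric])
    finally show ?thesis .
  qed
  also have "\<dots> = (\<Sum>i<k. d i * (?z $ i)\<^sup>2)" by (rule quadratic_form_diagonalization[OF U(1) y DU])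
  also have "\<dots> \<le> (\<Sum>i<k. S $$ (j, j) * (?z $ i)\<^sup>2)" using le by (intro sum_mono mult_right_mono) auto
  also have "\<dots> = S $$ (j, j) * (?z \<bullet> ?z)"
    using U y by (simp add: scalar_prod_def power2_eq_square atLeast0LessThan sum_distrib_left)
  also have "?z \<bullet> ?z = y \<bullet> y"
    using U y by (intro scalar_prod_isometry[of _ k k]) auto
  also have "y \<bullet> y = w \<bullet> w" unfolding wy by (rule scalar_prod_isometry[OF V VV y y, symmetric])
  finally show ?thesis .
qed

section \<open>The polar factor and perturbation bounds\<close>

lemma conjugated_diag_carrier:
  fixes U :: "real mat"
  assumes "U \<in> carrier_mat n n"
  shows "U * mat_diag n f * U\<^sup>T \<in> carrier_mat n n"
  using assms mat_diag_dim[of n f] by (metis mult_carrier_mat transpose_carrier_mat)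

text \<open>Functional calculus in a fixed orthonormal eigenbasis; it provides square roots and
  inverse square roots of \<open>X\<^sup>T * X\<close>.\<close>

lemma conjugated_diag_mult:
  fixes U :: "real mat"
  assumes U: "U \<in> carrier_mat n n" "U\<^sup>T * U = 1\<^sub>m n"
  shows "(U * mat_diag n f * U\<^sup>T) * (U * mat_diag n g * U\<^sup>T) = U * mat_diag n (\<lambda>i. f i * g i) * U\<^sup>T"
proof -
  let ?F = "mat_diag n f" and ?G = "mat_diag n g"
  have F: "?F \<in> carrier_mat n n" and G: "?G \<in> carrier_mat n n" and UT: "U\<^sup>T \<in> carrier_mat n n"
    using U by simp_all
  have UF: "U * ?F \<in> carrier_mat n n" and GU: "?G * U\<^sup>T \<in> carrier_mat n n"
    by (rule mult_carrier_mat[OF U(1) F] mult_carrier_mat[OF G UT])+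
  have "(U * ?F * U\<^sup>T) * (U * ?G * U\<^sup>T) = U * ?F * U\<^sup>T * (U * (?G * U\<^sup>T))"
    unfolding assoc_mult_mat[OF U(1) G UT] ..
  also have "\<dots> = U * ?F * (U\<^sup>T * (U * (?G * U\<^sup>T)))"
    by (rule assoc_mult_mat[OF UF UT mult_carrier_mat[OF U(1) GU]])
  also have "U\<^sup>T * (U * (?G * U\<^sup>T)) = ?G * U\<^sup>T"
    unfolding assoc_mult_mat[OF UT U(1) GU, symmetric] U(2) by (rule left_mult_one_mat[OF GU])
  also have "U * ?F * (?G * U\<^sup>T) = U * (?F * ?G) * U\<^sup>T"
    unfolding assoc_mult_mat[OF UF G UT, symmetric] assoc_mult_mat[OF U(1) F G] ..
  finally show ?thesis by simp
qed

lemma conjugated_diag_transpose: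
  fixes U :: "real mat"
  assumes "U \<in> carrier_mat n n"
  shows "(U * mat_diag n f * U\<^sup>T)\<^sup>T = U * mat_diag n f * U\<^sup>T"
proof -
  have "(mat_diag n f)\<^sup>T = mat_diag n f" by (rule eq_matI) (auto simp: mat_diag_def)
  then show ?thesis
    using congruence_symmetric[of "mat_diag n f" n "U\<^sup>T" n] assms by simp
qed

lemma mat_diag_cong: "(\<And>i. i < n \<Longrightarrow> f i = g i) \<Longrightarrow> mat_diag n f = mat_diag n g"
  by (rule eq_matI) (auto simp: mat_diag_def)

lemma conjugated_diag_one:
  fixes U :: "real mat"
  assumes "U \<in> carrier_mat n n" "U * U\<^sup>T = 1\<^sub>m n" "\<And>i. i < n \<Longrightarrow> f i = 1"
  shows "U * mat_diag n f * U\<^sup>T = 1\<^sub>m n"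
  using assms mat_diag_cong[of n f "\<lambda>_. 1"] by simp

text \<open>In the eigenbasis the difference is diagonal with entries \<open>1 - f i\<close>, and
  both changes of basis are isometries.\<close>

lemma vec_norm2_diff_conjugated_diag:
  fixes U :: "real mat"
  assumes U: "U \<in> carrier_mat n n" "U\<^sup>T * U = 1\<^sub>m n" "U * U\<^sup>T = 1\<^sub>m n" and y: "y \<in> carrier_vec n"
    and c: "\<And>i. i < n \<Longrightarrow> \<bar>1 - f i\<bar> \<le> c" "0 \<le> c"
  shows "vec_norm2 (y - U * mat_diag n f * U\<^sup>T *\<^sub>v y) \<le> c * vec_norm2 y"
proof -
  define z where "z = U\<^sup>T *\<^sub>v y"
  have UT: "U\<^sup>T \<in> carrier_mat n n" using U by simp
  have z: "z \<in> carrier_vec n" unfolding z_def by (rule mult_mat_vec_carrier[OF UT y])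
  have "U *\<^sub>v z = y" unfolding z_def using assoc_mult_mat_vec[OF U(1) UT y] U(3) y by simp
  then have "y - U * mat_diag n f * U\<^sup>T *\<^sub>v y = U *\<^sub>v z - U *\<^sub>v (mat_diag n f *\<^sub>v z)"
    using conjugated_diag_mult_vec[OF U(1) y, of f] by (simp add: z_def)
  also have "\<dots> = U *\<^sub>v (z - mat_diag n f *\<^sub>v z)"
    using mult_minus_distrib_mat_vec[OF U(1) z mult_mat_vec_carrier[OF mat_diag_dim z]] by simp
  finally have "vec_norm2 (y - U * mat_diag n f * U\<^sup>T *\<^sub>v y) = vec_norm2 (z - mat_diag n f *\<^sub>v z)"
    using vec_norm2_isometry[OF U(1,2)] z mult_mat_vec_carrier[OF mat_diag_dim z] by simp
  also have "\<dots> = L2_set (\<lambda>i. (1 - f i) * z $ i) {..<n}"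
    using z by (simp add: mat_diag_mult_vec vec_norm2_eq_L2 L2_set_def algebra_simps)
  also have "\<dots> = L2_set (\<lambda>i. \<bar>1 - f i\<bar> * \<bar>z $ i\<bar>) {..<n}"
    by (simp add: L2_set_def power_mult_distrib)
  also have "\<dots> \<le> L2_set (\<lambda>i. c * \<bar>z $ i\<bar>) {..<n}"
    using c by (intro L2_set_mono mult_right_mono) auto
  also have "\<dots> = c * vec_norm2 z"
    using L2_set_right_distrib[OF c(2), of "\<lambda>i. \<bar>z $ i\<bar>"] z by (simp add: vec_norm2_eq_L2 L2_set_def)
  also have "vec_norm2 z = vec_norm2 y"
    unfolding z_def using U by (intro vec_norm2_isometry[OF UT _ y]) simp
  finally show ?thesis .
qed

text \<open>\<open>R\<close> is the orthogonal factor of the polar decomposition of \<open>X\<^sup>T\<close>.\<close>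

lemma near_orthogonal_polar_factor:
  fixes X U :: "real mat"
  assumes X: "X \<in> carrier_mat r r" and U: "U \<in> carrier_mat r r" "U\<^sup>T * U = 1\<^sub>m r" "U * U\<^sup>T = 1\<^sub>m r"
    and XX: "X\<^sup>T * X = U * mat_diag r d * U\<^sup>T"
    and d: "\<And>i. i < r \<Longrightarrow> 0 < d i" "\<And>i. i < r \<Longrightarrow> d i \<le> 1" "\<And>i. i < r \<Longrightarrow> 1 - d i \<le> \<tau>" and \<tau>: "0 \<le> \<tau>"
  shows "\<exists>R. real_orthogonal r R \<and> R * R\<^sup>T = 1\<^sub>m r \<and>
    (\<forall>x\<in>carrier_vec r. vec_norm2 (x - (X * R)\<^sup>T *\<^sub>v x) \<le> \<tau> * vec_norm2 x)"
proof -
  \<comment> \<open>\<open>H\<close> and \<open>K\<close> are the inverse square root and the square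
    root of \<open>X\<^sup>T * X\<close>. Thus \<open>X\<^sup>T = K * R\<close>, and the identity
    minus \<open>(X * R)\<^sup>T\<close> is the identity minus \<open>K\<close>, conjugated by
    \<open>R\<close>.\<close>
  define H where "H = U * mat_diag r (\<lambda>i. 1 / sqrt (d i)) * U\<^sup>T"
  define K where "K = U * mat_diag r (\<lambda>i. sqrt (d i)) * U\<^sup>T"
  define R where "R = H * X\<^sup>T"
  have H: "H \<in> carrier_mat r r" and K: "K \<in> carrier_mat r r"
    unfolding H_def K_def by (rule conjugated_diag_carrier[OF U(1)])+
  have XT: "X\<^sup>T \<in> carrier_mat r r" using X by simp
  have R: "R \<in> carrier_mat r r" unfolding R_def by (rule mult_carrier_mat[OF H XT])
  have RT: "R\<^sup>T \<in> carrier_mat r r" using R by simp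
  have HT: "H\<^sup>T = H" unfolding H_def by (rule conjugated_diag_transpose[OF U(1)])
  have RT_eq: "R\<^sup>T = X * H" unfolding R_def using transpose_mult[OF H XT] HT by simp
  have "R * R\<^sup>T = H * X\<^sup>T * (X * H)" unfolding RT_eq by (simp add: R_def)
  also have "\<dots> = H * (X\<^sup>T * X) * H"
    unfolding assoc_mult_mat[OF H XT mult_carrier_mat[OF X H]] assoc_mult_mat[OF XT X H, symmetric]
      assoc_mult_mat[OF H mult_carrier_mat[OF XT X] H] ..
  also have "\<dots> = U * mat_diag r (\<lambda>i. 1 / sqrt (d i) * d i * (1 / sqrt (d i))) * U\<^sup>T"
    unfolding XX H_def conjugated_diag_mult[OF U(1,2)] ..
  also have "\<dots> = 1\<^sub>m r"
  proof (rule conjugated_diag_one[OF U(1,3)])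
    fix i assume "i < r"
    from d(1)[OF this] show "1 / sqrt (d i) * d i * (1 / sqrt (d i)) = 1" by simp
  qed
  finally have RR: "R * R\<^sup>T = 1\<^sub>m r" .
  have RR': "R\<^sup>T * R = 1\<^sub>m r" by (rule mat_mult_left_right_inverse[OF R RT RR])
  have "K * H = U * mat_diag r (\<lambda>i. sqrt (d i) * (1 / sqrt (d i))) * U\<^sup>T"
    unfolding K_def H_def by (rule conjugated_diag_mult[OF U(1,2)])
  also have "\<dots> = 1\<^sub>m r"
  proof (rule conjugated_diag_one[OF U(1,3)])
    fix i assume "i < r"
    from d(1)[OF this] show "sqrt (d i) * (1 / sqrt (d i)) = 1" by simp
  qed
  finally have KH: "K * H = 1\<^sub>m r" .
  have KR: "K * R = X\<^sup>T" unfolding R_def using assoc_mult_mat[OF K H XT] KH XT by simp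
  have "vec_norm2 (x - (X * R)\<^sup>T *\<^sub>v x) \<le> \<tau> * vec_norm2 x" if x: "x \<in> carrier_vec r" for x
  proof -
    define y where "y = R *\<^sub>v x"
    have y: "y \<in> carrier_vec r" unfolding y_def by (rule mult_mat_vec_carrier[OF R x])
    have Ky: "K *\<^sub>v y \<in> carrier_vec r" by (rule mult_mat_vec_carrier[OF K y])
    have xy: "x = R\<^sup>T *\<^sub>v y" unfolding y_def using assoc_mult_mat_vec[OF RT R x] RR' x by simp
    have "(X * R)\<^sup>T *\<^sub>v x = R\<^sup>T *\<^sub>v (X\<^sup>T *\<^sub>v x)"
      using transpose_mult[OF X R] assoc_mult_mat_vec[OF RT XT x] by simp
    also have "X\<^sup>T *\<^sub>v x = K *\<^sub>v y"
      unfolding y_def KR[symmetric] by (rule assoc_mult_mat_vec[OF K R x])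
    finally have "x - (X * R)\<^sup>T *\<^sub>v x = R\<^sup>T *\<^sub>v y - R\<^sup>T *\<^sub>v (K *\<^sub>v y)" using xy by simp
    also have "\<dots> = R\<^sup>T *\<^sub>v (y - K *\<^sub>v y)" by (rule mult_minus_distrib_mat_vec[OF RT y Ky, symmetric])
    finally have "vec_norm2 (x - (X * R)\<^sup>T *\<^sub>v x) = vec_norm2 (R\<^sup>T *\<^sub>v (y - K *\<^sub>v y))" by simp
    also have "\<dots> = vec_norm2 (y - K *\<^sub>v y)"
      using RR y Ky by (intro vec_norm2_isometry[OF RT]) auto
    also have "\<dots> \<le> \<tau> * vec_norm2 y"
      unfolding K_def
    proof (rule vec_norm2_diff_conjugated_diag[OF U y _ \<tau>])
      fix i assume i: "i < r"
      \<comment> \<open>On the unit interval 1 - sqrt d \<le> 1 - d. This keeps the deviation at the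
        size \<tau> of a squared sine instead of its root.\<close>
      have "d i \<le> sqrt (d i)"
        using d(1,2)[OF i] by (intro real_le_rsqrt) (simp add: power2_eq_square mult_left_le)
      moreover have "sqrt (d i) \<le> 1" using d(2)[OF i] by simp
      ultimately show "\<bar>1 - sqrt (d i)\<bar> \<le> \<tau>" using d(3)[OF i] by simp
    qed
    also have "vec_norm2 y = vec_norm2 x" unfolding y_def by (rule vec_norm2_isometry[OF R RR' x])
    finally show ?thesis .
  qed
  moreover have "real_orthogonal r R" using R RR' by (simp add: real_orthogonal_def orthonormal_cols_def)
  ultimately show ?thesis using RR by blast
qed

lemma diagonal_mat_eq_mat_diag:
  assumes "S \<in> carrier_mat r r" "diagonal_mat S"
  shows "S = mat_diag r (\<lambda>j. S $$ (j, j))"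
  using assms by (intro eq_matI) (auto simp: mat_diag_def diagonal_mat_def)

text \<open>The Courant--Fischer argument behind Weyl's inequality: some unit vector of the range of
  \<open>V\<close> is orthogonal to all columns of \<open>Q\<close> except the \<open>j\<close>-th one.\<close>

lemma ritz_value_ge:
  fixes A V Q S E :: "real mat"
  assumes A: "A \<in> carrier_mat n n" "A\<^sup>T = A" and Q: "Q \<in> carrier_mat n r" "Q\<^sup>T * Q = 1\<^sub>m r"
    and V: "V \<in> carrier_mat n r" "V\<^sup>T * V = 1\<^sub>m r" and VAV: "V\<^sup>T * A * V = mat_diag r lam"
    and lam: "\<And>i. i < r \<Longrightarrow> \<mu> \<le> lam i"
    and S: "S \<in> carrier_mat r r" "diagonal_mat S" and E: "E \<in> carrier_mat n r" and rn: "r \<le> n"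
    and residual: "A * Q - Q * S = E"
    and leading: "leading_invariant_subspace r (A - E * Q\<^sup>T) (mat_range Q)"
    and j: "j < r"
  shows "\<mu> - 2 * spectral_norm E \<le> S $$ (j, j)"
proof -
  let ?\<epsilon> = "spectral_norm E"
  have \<epsilon>: "0 \<le> ?\<epsilon>" using spectral_norm_nonneg[of E] E j by simp
  have QT: "Q\<^sup>T \<in> carrier_mat r n" using Q by simp
  \<comment> \<open>\<open>Q\<^sup>T * V\<close> with row \<open>j\<close> deleted: r - 1 equations
    in r unknowns, hence a unit solution \<open>a\<close>.\<close>
  let ?N = "mat (r - 1) r (\<lambda>(i, l). (Q\<^sup>T * V) $$ (if i < j then i else Suc i, l))"
  have N: "?N \<in> carrier_mat (r - 1) r" by simp
  obtain a where a: "a \<in> carrier_vec r" "?N *\<^sub>v a = 0\<^sub>v (r - 1)" "vec_norm2 a = 1"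
    using wide_matrix_kernel[OF N] j by auto
  define x where "x = V *\<^sub>v a"
  have x: "x \<in> carrier_vec n" unfolding x_def by (rule mult_mat_vec_carrier[OF V(1) a(1)])
  have xx: "x \<bullet> x = 1"
    unfolding x_def scalar_prod_isometry[OF V a(1) a(1)] using vec_norm2_power2[of a] a(3) by simp
  have colc: "col Q i \<in> carrier_vec n" if "i < r" for i using Q that by auto
  have orth: "col Q i \<bullet> x = 0" if i: "i < r" "i \<noteq> j" for i
  proof -
    define i' where "i' = (if i < j then i else i - 1)"
    have i': "i' < r - 1" "(if i' < j then i' else Suc i') = i" using i j by (auto simp: i'_def)
    have "row ?N i' = row (Q\<^sup>T * V) i" using i' i Q V by (intro eq_vecI) auto
    then have "row (Q\<^sup>T * V) i \<bullet> a = (?N *\<^sub>v a) $ i'" using i' by simp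
    also have "\<dots> = 0" using a(2) i' by simp
    finally have "(Q\<^sup>T * V *\<^sub>v a) $ i = 0" using i Q V by simp
    moreover have "Q\<^sup>T * V *\<^sub>v a = Q\<^sup>T *\<^sub>v x" unfolding x_def by (rule assoc_mult_mat_vec[OF QT V(1) a(1)])
    ultimately show ?thesis using i Q by simp
  qed
  have qq: "col Q i \<bullet> col Q k = (if i = k then 1 else 0)" if "i < r" "k < r" for i k
    using orthonormal_vecs_nth(2)[OF orthonormal_vecs_cols[OF Q], of i k] that Q by simp
  define q where "q = col Q j"
  define y where "y = q \<bullet> x"
  \<comment> \<open>Removing the component along \<open>q\<close> makes \<open>w\<close> orthogonal
    to all columns of \<open>Q\<close>, the situation of \<open>leading_rayleigh_le\<close>.\<close>
  define w where "w = x - y \<cdot>\<^sub>v q"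
  define f where "f = col E j"
  define s where "s = S $$ (j, j)"
  have q: "q \<in> carrier_vec n" unfolding q_def by (rule colc[OF j])
  have w: "w \<in> carrier_vec n" unfolding w_def using x q by simp
  have f: "f \<in> carrier_vec n" using E j by (auto simp: f_def)
  have wo: "col Q i \<bullet> w = 0" if "i < r" for i
  proof -
    have "col Q i \<bullet> w = col Q i \<bullet> x - y * (col Q i \<bullet> q)"
      unfolding w_def using colc[OF that] x q by (simp add: scalar_prod_minus_distrib[of _ n])
    then show ?thesis using orth[OF that] qq[OF that j] by (cases "i = j") (auto simp: q_def y_def)
  qed
  have qw: "q \<bullet> w = 0" unfolding q_def by (rule wo[OF j])
  have wq: "w \<bullet> q = 0" using qw comm_scalar_prod[OF w q] by simp
  have xdec: "x = y \<cdot>\<^sub>v q + w" unfolding w_def using x q by auto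
  have yq: "y \<cdot>\<^sub>v q \<in> carrier_vec n" using q by simp
  have Aq: "A *\<^sub>v q = s \<cdot>\<^sub>v q + f"
  proof -
    have "col (A * Q) j = A *\<^sub>v q" unfolding q_def by (rule col_mult2[OF A(1) Q(1) j])
    moreover have "col (Q * S) j = s \<cdot>\<^sub>v q"
      using mat_diag_mult_right[OF Q(1), of "\<lambda>j. S $$ (j, j)"] diagonal_mat_eq_mat_diag[OF S] Q j
      by (intro eq_vecI) (auto simp: s_def q_def)
    moreover have "f = col (A * Q) j - col (Q * S) j"
    proof -
      have "f = col (A * Q - Q * S) j" using residual by (simp add: f_def)
      also have "\<dots> = col (A * Q) j - col (Q * S) j"
        using j A Q S by (intro eq_vecI) auto
      finally show ?thesis .
    qed
    ultimately show ?thesis using q A by auto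
  qed
  have Ax: "A *\<^sub>v x = y \<cdot>\<^sub>v (A *\<^sub>v q) + A *\<^sub>v w"
    unfolding xdec using mult_add_distrib_mat_vec[OF A(1) yq w] mult_mat_vec[OF A(1) q] by simp
  have Aqc: "A *\<^sub>v q \<in> carrier_vec n" and Awc: "A *\<^sub>v w \<in> carrier_vec n"
    using A q w by (auto intro: mult_mat_vec_carrier[of _ n n])
  have symA: "u \<bullet> (A *\<^sub>v v) = (A *\<^sub>v u) \<bullet> v" if "u \<in> carrier_vec n" "v \<in> carrier_vec n" for u v
    using scalar_prod_mult_mat_vec[OF A(1) that] A(2) by simp
  have q1: "q \<bullet> q = 1" using qq[OF j j] by (simp add: q_def)
  have qAq: "q \<bullet> (A *\<^sub>v q) = s + f \<bullet> q"
    unfolding Aq using q f q1 by (simp add: scalar_prod_add_distrib[of _ n] comm_scalar_prod[of f n q])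
  have wAq: "w \<bullet> (A *\<^sub>v q) = f \<bullet> w"
    unfolding Aq using q f w wq by (simp add: scalar_prod_add_distrib[of _ n] comm_scalar_prod[of f n w])
  have qAw: "q \<bullet> (A *\<^sub>v w) = f \<bullet> w"
    unfolding symA[OF q w] Aq using q f w qw by (simp add: add_scalar_prod_distrib[of _ n])
  \<comment> \<open>Expansion along x = y q + w. Since A q = s q + f and q is orthogonal to w, both
    mixed products reduce to the product of f with w.\<close>
  have "x \<bullet> (A *\<^sub>v x) = y * (q \<bullet> (A *\<^sub>v x)) + w \<bullet> (A *\<^sub>v x)"
    using xdec q w yq mult_mat_vec_carrier[OF A(1) x] add_scalar_prod_distrib[OF yq w, of "A *\<^sub>v x"] by simp
  also have "q \<bullet> (A *\<^sub>v x) = y * (s + f \<bullet> q) + f \<bullet> w"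
    unfolding Ax using q Aqc Awc qAq qAw by (simp add: scalar_prod_add_distrib[of _ n])
  also have "w \<bullet> (A *\<^sub>v x) = y * (f \<bullet> w) + w \<bullet> (A *\<^sub>v w)"
    unfolding Ax using w Aqc Awc wAq by (simp add: scalar_prod_add_distrib[of _ n])
  finally have quad: "x \<bullet> (A *\<^sub>v x) = s * y\<^sup>2 + y * (y * (f \<bullet> q) + 2 * (f \<bullet> w)) + w \<bullet> (A *\<^sub>v w)"
    by (simp add: power2_eq_square algebra_simps)
  have xw: "x \<bullet> x = y\<^sup>2 + w \<bullet> w"
  proof -
    have "x \<bullet> x = y * (q \<bullet> x) + w \<bullet> x"
      using xdec q w yq x add_scalar_prod_distrib[OF yq w x] by simp
    also have "w \<bullet> x = w \<bullet> w"
      using xdec w yq q wq scalar_prod_add_distrib[OF w yq w] by simp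
    finally show ?thesis by (simp add: y_def power2_eq_square)
  qed
  have y1: "\<bar>y\<bar> \<le> 1"
  proof -
    have "y\<^sup>2 \<le> 1" using xw xx vec_norm2_power2[of w] zero_le_power2[of "vec_norm2 w"] by linarith
    then show ?thesis by (simp add: abs_square_le_1)
  qed
  have nw: "(vec_norm2 w)\<^sup>2 = 1 - y\<^sup>2" using vec_norm2_power2[of w] xw xx by simp
  have nf: "vec_norm2 f \<le> ?\<epsilon>"
  proof -
    have "f = E *\<^sub>v unit_vec r j" unfolding f_def using E j by (intro eq_vecI) auto
    moreover have "vec_norm2 (unit_vec r j) = 1"
      using vec_norm2_power2[of "unit_vec r j"] vec_norm2_nonneg[of "unit_vec r j"] j by (simp add: power2_eq_1_iff)
    ultimately show ?thesis
      using vec_norm2_mult_mat_vec_le_spectral_norm[OF E, of "unit_vec r j"] by simp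
  qed
  \<comment> \<open>y q + 2 w = x + w, so all terms containing the residual collapse into y times
    one inner product with \<open>f\<close>. As x has norm one and w norm at most one, the constant
    2 in front of the spectral norm appears.\<close>
  define g where "g = x + w"
  have g: "g \<in> carrier_vec n" using x w by (simp add: g_def)
  have fg: "y * (f \<bullet> q) + 2 * (f \<bullet> w) = f \<bullet> g"
    unfolding g_def using xdec f q w yq x
    by (simp add: scalar_prod_add_distrib[of _ n] scalar_prod_add_distrib[OF f yq w])
  have ng: "vec_norm2 g \<le> 2"
  proof -
    have "vec_norm2 x = 1" using vec_norm2_power2[of x] xx vec_norm2_nonneg[of x] by (simp add: power2_eq_1_iff)
    moreover have "vec_norm2 w \<le> 1" by (rule power2_le_imp_le) (simp_all add: nw)
    ultimately show ?thesis unfolding g_def using vec_norm2_triangle[OF x w] by simp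
  qed
  have "y * (f \<bullet> g) \<le> \<bar>y\<bar> * \<bar>f \<bullet> g\<bar>" by (simp add: abs_mult[symmetric])
  also have "\<dots> \<le> 1 * (?\<epsilon> * 2)"
    using y1 abs_scalar_prod_le[OF f g] mult_mono[OF nf ng \<epsilon> vec_norm2_nonneg]
    by (intro mult_mono) auto
  finally have yfg: "y * (f \<bullet> g) \<le> 2 * ?\<epsilon>" by simp
  have "w \<bullet> (A *\<^sub>v w) \<le> s * (w \<bullet> w)"
    unfolding s_def by (rule leading_rayleigh_le[OF A Q S E rn residual leading w wo j])
  then have "x \<bullet> (A *\<^sub>v x) \<le> s * (y\<^sup>2 + w \<bullet> w) + 2 * ?\<epsilon>"
    using quad yfg unfolding fg by (simp add: algebra_simps)
  then have up: "x \<bullet> (A *\<^sub>v x) \<le> s + 2 * ?\<epsilon>" using xw xx by simp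
  have "x \<bullet> (A *\<^sub>v x) = a \<bullet> (V\<^sup>T *\<^sub>v (A *\<^sub>v (V *\<^sub>v a)))"
    using scalar_prod_mult_mat_vec[OF V(1) a(1) mult_mat_vec_carrier[OF A(1) x]] by (simp add: x_def)
  also have "\<dots> = a \<bullet> (mat_diag r lam *\<^sub>v a)"
    using congruence_mult_mat_vec[OF A(1) V(1) a(1)] VAV by simp
  also have "\<dots> = (\<Sum>i<r. lam i * (a $ i)\<^sup>2)" by (rule mat_diag_quadratic_form[OF a(1)])
  also have "\<dots> \<ge> (\<Sum>i<r. \<mu> * (a $ i)\<^sup>2)" using lam by (intro sum_mono mult_right_mono) auto
  also have "(\<Sum>i<r. \<mu> * (a $ i)\<^sup>2) = \<mu> * (vec_norm2 a)\<^sup>2"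
    unfolding vec_norm2_power2 using a(1) by (simp add: scalar_prod_def power2_eq_square atLeast0LessThan sum_distrib_left)
  finally have "\<mu> \<le> x \<bullet> (A *\<^sub>v x)" using a(3) by simp
  then show ?thesis using up by (simp add: s_def)
qed

text \<open>The Davis--Kahan argument, tested on an eigenvector \<open>u\<close> of \<open>Y\<^sup>T * Y\<close>.\<close>

lemma sylvester_gram_eigenvalue_le:
  fixes Y S F :: "real mat"
  assumes Y: "Y \<in> carrier_mat p r" and F: "F \<in> carrier_mat p r"
    and sylv: "mat_diag p l * Y - Y * mat_diag r s = F"
    and l: "\<And>i. i < p \<Longrightarrow> l i \<le> \<beta>" and s: "\<And>j. j < r \<Longrightarrow> \<alpha> \<le> s j" and gap: "\<beta> < \<alpha>"
    and bound: "\<And>x. x \<in> carrier_vec r \<Longrightarrow> vec_norm2 (F *\<^sub>v x) \<le> \<epsilon> * vec_norm2 x"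
    and u: "u \<in> carrier_vec r" "vec_norm2 u = 1" "Y\<^sup>T * Y *\<^sub>v u = t \<cdot>\<^sub>v u"
  shows "0 \<le> t" "t \<le> (\<epsilon> / (\<alpha> - \<beta>))\<^sup>2"
proof -
  define v where "v = Y *\<^sub>v u"
  let ?L = "mat_diag p l" and ?S = "mat_diag r s"
  have YT: "Y\<^sup>T \<in> carrier_mat r p" using Y by simp
  have v: "v \<in> carrier_vec p" unfolding v_def by (rule mult_mat_vec_carrier[OF Y u(1)])
  have Lv: "?L *\<^sub>v v \<in> carrier_vec p" by (rule mult_mat_vec_carrier[OF mat_diag_dim v])
  have Su: "?S *\<^sub>v u \<in> carrier_vec r" by (rule mult_mat_vec_carrier[OF mat_diag_dim u(1)])
  have YSu: "Y *\<^sub>v (?S *\<^sub>v u) \<in> carrier_vec p" by (rule mult_mat_vec_carrier[OF Y Su])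
  \<comment> \<open>The reason for testing on an eigenvector: \<open>Y\<^sup>T\<close> maps
    \<open>v\<close> back to a multiple of \<open>u\<close>, so the term with \<open>S\<close>
    becomes t times a Rayleigh quotient at \<open>u\<close>, which is at least \<alpha>.\<close>
  have YTv: "Y\<^sup>T *\<^sub>v v = t \<cdot>\<^sub>v u"
    unfolding v_def using assoc_mult_mat_vec[OF YT Y u(1)] u(3) by simp
  have uu: "u \<bullet> u = 1" using vec_norm2_power2[of u] u(2) by simp
  have vv: "v \<bullet> v = t"
    using scalar_prod_mult_mat_vec[OF Y u(1) v] u(1) uu YTv by (simp add: v_def[symmetric])
  then show t: "0 \<le> t" using vec_norm2_power2[of v] zero_le_power2[of "vec_norm2 v"] by simp
  have nv: "vec_norm2 v = sqrt t" using vec_norm2_power2[of v] vv by (simp add: real_sqrt_unique)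
  have "F *\<^sub>v u = ?L *\<^sub>v v - Y *\<^sub>v (?S *\<^sub>v u)"
    unfolding sylv[symmetric] v_def
    using minus_mult_distrib_mat_vec[of "?L * Y" p r "Y * ?S" u] Y u(1) mat_diag_dim[of p l] mat_diag_dim[of r s]
    by (simp add: assoc_mult_mat_vec[of _ p p _ r] assoc_mult_mat_vec[of _ p r _ r])
  then have e: "v \<bullet> (F *\<^sub>v u) = v \<bullet> (?L *\<^sub>v v) - v \<bullet> (Y *\<^sub>v (?S *\<^sub>v u))"
    using v Lv YSu by (simp add: scalar_prod_minus_distrib[of _ p])
  have "v \<bullet> (Y *\<^sub>v (?S *\<^sub>v u)) = (Y *\<^sub>v (?S *\<^sub>v u)) \<bullet> v" by (rule comm_scalar_prod[OF v YSu])
  also have "\<dots> = (?S *\<^sub>v u) \<bullet> (t \<cdot>\<^sub>v u)"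
    using scalar_prod_mult_mat_vec[OF Y Su v] YTv by simp
  also have "\<dots> = t * (u \<bullet> (?S *\<^sub>v u))"
    using Su u(1) comm_scalar_prod[OF Su u(1)] by simp
  also have "u \<bullet> (?S *\<^sub>v u) = (\<Sum>j<r. s j * (u $ j)\<^sup>2)" by (rule mat_diag_quadratic_form[OF u(1)])
  finally have e2: "v \<bullet> (Y *\<^sub>v (?S *\<^sub>v u)) = t * (\<Sum>j<r. s j * (u $ j)\<^sup>2)" .
  have "(\<Sum>j<r. \<alpha> * (u $ j)\<^sup>2) \<le> (\<Sum>j<r. s j * (u $ j)\<^sup>2)" using s by (intro sum_mono mult_right_mono) auto
  moreover have "(\<Sum>j<r. \<alpha> * (u $ j)\<^sup>2) = \<alpha> * (u \<bullet> u)"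
    using u(1) by (simp add: scalar_prod_def power2_eq_square atLeast0LessThan sum_distrib_left)
  ultimately have low: "t * \<alpha> \<le> v \<bullet> (Y *\<^sub>v (?S *\<^sub>v u))" using e2 uu t by (simp add: mult_left_mono)
  have "v \<bullet> (?L *\<^sub>v v) = (\<Sum>i<p. l i * (v $ i)\<^sup>2)" by (rule mat_diag_quadratic_form[OF v])
  also have "\<dots> \<le> (\<Sum>i<p. \<beta> * (v $ i)\<^sup>2)" using l by (intro sum_mono mult_right_mono) auto
  also have "\<dots> = \<beta> * (v \<bullet> v)"
    using v by (simp add: scalar_prod_def power2_eq_square atLeast0LessThan sum_distrib_left)
  finally have "t * (\<alpha> - \<beta>) \<le> - (v \<bullet> (F *\<^sub>v u))" using e low vv by (simp add: algebra_simps)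
  also have "\<dots> \<le> vec_norm2 v * vec_norm2 (F *\<^sub>v u)"
    using abs_scalar_prod_le[OF v mult_mat_vec_carrier[OF F u(1)]] by simp
  also have "\<dots> \<le> sqrt t * \<epsilon>"
    using bound[OF u(1)] u(2) nv by (simp add: mult_left_mono t)
  finally have main: "t * (\<alpha> - \<beta>) \<le> sqrt t * \<epsilon>" .
  show "t \<le> (\<epsilon> / (\<alpha> - \<beta>))\<^sup>2"
  proof (cases "t = 0")
    case False
    then have st: "0 < sqrt t" using t by simp
    have "sqrt t * (sqrt t * (\<alpha> - \<beta>)) \<le> sqrt t * \<epsilon>" using main t by (simp add: mult.assoc[symmetric])
    then have "sqrt t * (\<alpha> - \<beta>) \<le> \<epsilon>" using st by (rule mult_left_le_imp_le)
    then have "sqrt t \<le> \<epsilon> / (\<alpha> - \<beta>)" using gap by (simp add: field_simps)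
    then have "(sqrt t)\<^sup>2 \<le> (\<epsilon> / (\<alpha> - \<beta>))\<^sup>2" using t by (intro power_mono) auto
    then show ?thesis using t by simp
  qed simp
qed

text \<open>Homogeneity removes the normalization in the infimum: a matrix of nonzero norm is scaled
  to norm one, and for norm zero the left side vanishes. The infimum bounds its members from below
  because 0 is a lower bound of the set.\<close>

lemma sep_2_inf_le:
  assumes C: "C \<in> carrier_mat n n" and B: "B \<in> carrier_mat r r" and W: "W \<in> carrier_mat n r" and "0 < n"
    and P: "P \<in> carrier_mat n p"
    and range: "\<And>j. j < r \<Longrightarrow> col W j \<in> mat_range P"
  shows "sep_2_inf P B C * norm_2_inf W \<le> norm_2_inf (W * B - C * W)"
proof (cases "norm_2_inf W = 0")
  case True
  have "W * B - C * W \<in> carrier_mat n r" using C B W by (simp add: minus_carrier_mat)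
  from norm_2_inf_nonneg[OF this \<open>0 < n\<close>] show ?thesis using True by simp
next
  case False
  define c where "c = 1 / norm_2_inf W"
  have npos: "0 < norm_2_inf W" using False norm_2_inf_nonneg[OF W \<open>0 < n\<close>] by simp
  then have c: "0 < c" by (simp add: c_def)
  let ?Z = "c \<cdot>\<^sub>m W"
  let ?N = "{norm_2_inf (Z * B - C * Z) | Z. Z \<in> carrier_mat (dim_row C) (dim_row B) \<and> norm_2_inf Z = 1 \<and>
            (\<forall>j<dim_col Z. col Z j \<in> mat_range P)}"
  have Z: "?Z \<in> carrier_mat n r" using W by simp
  have "norm_2_inf ?Z = 1" using norm_2_inf_smult[OF W \<open>0 < n\<close>, of c] c npos by (simp add: c_def)
  moreover have "col ?Z j \<in> mat_range P" if j: "j < r" for j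
  proof -
    obtain x where x: "x \<in> carrier_vec p" "col W j = P *\<^sub>v x"
      using range[OF j] P unfolding mat_range_def by auto
    have "col ?Z j = P *\<^sub>v (c \<cdot>\<^sub>v x)"
      using W j x mult_mat_vec[OF P x(1), of c] by (simp add: col_smult)
    then show ?thesis using x(1) P unfolding mat_range_def by auto
  qed
  ultimately have "norm_2_inf (?Z * B - C * ?Z) \<in> ?N" using C B Z W by auto
  moreover have "bdd_below ?N"
  proof (rule bdd_belowI)
    fix a assume "a \<in> ?N"
    then obtain Z where "Z \<in> carrier_mat n r" "a = norm_2_inf (Z * B - C * Z)" using C B by auto
    moreover from this have "Z * B - C * Z \<in> carrier_mat n r" using C B by (simp add: minus_carrier_mat)
    ultimately show "0 \<le> a" using norm_2_inf_nonneg \<open>0 < n\<close> by auto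
  qed
  ultimately have "sep_2_inf P B C \<le> norm_2_inf (?Z * B - C * ?Z)"
    unfolding sep_2_inf_def by (rule cInf_lower)
  also have "?Z * B - C * ?Z = c \<cdot>\<^sub>m (W * B - C * W)"
    using C B W by (intro eq_matI) (auto simp: algebra_simps)
  also have "norm_2_inf \<dots> = c * norm_2_inf (W * B - C * W)"
    using norm_2_inf_smult[of "W * B - C * W" n r c] C B W \<open>0 < n\<close> c by (simp add: minus_carrier_mat)
  finally show ?thesis using npos by (simp add: c_def field_simps)
qed

lemma dist_2_inf_le:
  assumes U: "U \<in> carrier_mat n r" and W: "W \<in> carrier_mat n r" and R: "real_orthogonal r R" and "0 < n"
  shows "dist_2_inf U W \<le> norm_2_inf (U - W * R)"
  unfolding dist_2_inf_def
proof (rule cInf_lower)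
  show "norm_2_inf (U - W * R) \<in> {norm_2_inf (U - W * R) | R. real_orthogonal (dim_col W) R}"
    using R W by auto
  show "bdd_below {norm_2_inf (U - W * R) | R. real_orthogonal (dim_col W) R}"
  proof (rule bdd_belowI)
    fix a assume "a \<in> {norm_2_inf (U - W * R) | R. real_orthogonal (dim_col W) R}"
    then obtain R where "R \<in> carrier_mat r r" "a = norm_2_inf (U - W * R)"
      using W by (auto simp: real_orthogonal_def)
    moreover from this have "U - W * R \<in> carrier_mat n r" using U W by (simp add: minus_carrier_mat)
    ultimately show "0 \<le> a" using norm_2_inf_nonneg \<open>0 < n\<close> by auto
  qed
qed

text \<open>The first four identities are the blocks of \<open>P\<^sup>T * P\<close>. The last is
  \<open>P * P\<^sup>T\<close>, available because \<open>P\<close> is square and a left inverse is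
  then a right inverse.\<close>

lemma append_columns_orthogonal:
  assumes V: "V \<in> carrier_mat n r" and W: "W \<in> carrier_mat n k" and n: "n = r + k"
    and orth: "real_orthogonal n (append_columns V W)"
  shows "V\<^sup>T * V = 1\<^sub>m r" "W\<^sup>T * W = 1\<^sub>m k" "V\<^sup>T * W = 0\<^sub>m r k" "W\<^sup>T * V = 0\<^sub>m k r"
    "V * V\<^sup>T + W * W\<^sup>T = 1\<^sub>m n"
proof -
  define P where "P = append_columns V W"
  have P: "P \<in> carrier_mat n n" and PP: "P\<^sup>T * P = 1\<^sub>m n"
    using orth by (auto simp: P_def real_orthogonal_def orthonormal_cols_def)
  have PP': "P * P\<^sup>T = 1\<^sub>m n" using P by (intro mat_mult_left_right_inverse[OF _ P PP]) simp
  have idx: "P $$ (i, j) = (if j < r then V $$ (i, j) else W $$ (i, j - r))" if "i < n" "j < n" for i j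
    using that V W n unfolding P_def append_columns_def by (subst index_mat_four_block) auto
  have colV: "col P j = col V j" if "j < r" for j
    using that P V n by (intro eq_vecI) (auto simp: idx)
  have colW: "col P (j + r) = col W j" if "j < k" for j
    using that P W n by (intro eq_vecI) (auto simp: idx)
  have cc: "col P i \<bullet> col P j = (if i = j then 1 else 0)" if "i < n" "j < n" for i j
  proof -
    have "col P i \<bullet> col P j = (P\<^sup>T * P) $$ (i, j)" using that P by simp
    then show ?thesis unfolding PP using that by simp
  qed
  show "V\<^sup>T * V = 1\<^sub>m r"
    using V n cc by (intro eq_matI) (auto simp flip: colV)
  show "W\<^sup>T * W = 1\<^sub>m k"
    using W n cc by (intro eq_matI) (auto simp flip: colW)
  show "V\<^sup>T * W = 0\<^sub>m r k"
    using V W n cc by (intro eq_matI) (auto simp flip: colV colW)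
  show "W\<^sup>T * V = 0\<^sub>m k r"
    using V W n cc by (intro eq_matI) (auto simp flip: colV colW)
  have rowP: "row P i = row V i @\<^sub>v row W i" if "i < n" for i
    using that P V W n by (intro eq_vecI) (auto simp: idx)
  show "V * V\<^sup>T + W * W\<^sup>T = 1\<^sub>m n"
  proof (rule eq_matI)
    fix i j assume "i < dim_row (1\<^sub>m n :: real mat)" "j < dim_col (1\<^sub>m n :: real mat)"
    then have ij: "i < n" "j < n" by auto
    have "row P i \<bullet> row P j = row V i \<bullet> row V j + row W i \<bullet> row W j"
      unfolding rowP[OF ij(1)] rowP[OF ij(2)] using V W by (intro scalar_prod_append[of _ r _ k]) auto
    also have "row P i \<bullet> row P j = (P * P\<^sup>T) $$ (i, j)" using ij P by simp
    finally show "(V * V\<^sup>T + W * W\<^sup>T) $$ (i, j) = 1\<^sub>m n $$ (i, j)"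
      unfolding PP' using ij V W by simp
  qed (use W in auto)
qed

text \<open>Stated for an arbitrary pair of blocks, so that it applies to \<open>V\<close> against
  \<open>Vp\<close> and, with the summands exchanged, to \<open>Vp\<close> against
  \<open>V\<close>.\<close>

lemma transpose_mult_spectral_sum:
  fixes W :: "real mat"
  assumes W: "W \<in> carrier_mat n k" and W': "W' \<in> carrier_mat n l"
    and D: "D \<in> carrier_mat k k" and D': "D' \<in> carrier_mat l l"
    and WW: "W\<^sup>T * W = 1\<^sub>m k" and WW': "W\<^sup>T * W' = 0\<^sub>m k l"
  shows "W\<^sup>T * (W * D * W\<^sup>T + W' * D' * W'\<^sup>T) = D * W\<^sup>T"
proof -
  have WT: "W\<^sup>T \<in> carrier_mat k n" and W'T: "W'\<^sup>T \<in> carrier_mat l n" using W W' by auto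
  note DW = mult_carrier_mat[OF D WT] and DW' = mult_carrier_mat[OF D' W'T]
  have "W\<^sup>T * (W * D * W\<^sup>T + W' * D' * W'\<^sup>T) = W\<^sup>T * (W * (D * W\<^sup>T)) + W\<^sup>T * (W' * (D' * W'\<^sup>T))"
    unfolding assoc_mult_mat[OF W D WT] assoc_mult_mat[OF W' D' W'T]
    by (rule mult_add_distrib_mat[OF WT mult_carrier_mat[OF W DW] mult_carrier_mat[OF W' DW']])
  also have "\<dots> = D * W\<^sup>T"
    unfolding assoc_mult_mat[OF WT W DW, symmetric] assoc_mult_mat[OF WT W' DW', symmetric] WW WW'
      left_mult_one_mat[OF DW] left_mult_zero_mat[OF DW'] using right_add_zero_mat[OF DW] by simp
  finally show ?thesis .
qed

text \<open>\<open>W\<^sup>T\<close> is applied to the residual equation and moved past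
  \<open>A\<close>. With \<open>W\<close> equal to \<open>V\<close> and to \<open>Vp\<close> this
  gives the two Sylvester equations, for \<open>X\<close> and for \<open>Y\<close>.\<close>

lemma compressed_residual:
  fixes W :: "real mat"
  assumes A: "A \<in> carrier_mat n n" and Q: "Q \<in> carrier_mat n r" and S: "S \<in> carrier_mat r r"
    and residual: "A * Q - Q * S = E"
    and W: "W \<in> carrier_mat n k" and D: "D \<in> carrier_mat k k" and WA: "W\<^sup>T * A = D * W\<^sup>T"
  shows "D * (W\<^sup>T * Q) - W\<^sup>T * Q * S = W\<^sup>T * E"
proof -
  have WT: "W\<^sup>T \<in> carrier_mat k n" using W by simp
  have "W\<^sup>T * E = W\<^sup>T * (A * Q) - W\<^sup>T * (Q * S)"
    unfolding residual[symmetric]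
    by (rule mult_minus_distrib_mat[OF WT mult_carrier_mat[OF A Q] mult_carrier_mat[OF Q S]])
  then show ?thesis
    unfolding assoc_mult_mat[OF WT A Q, symmetric] assoc_mult_mat[OF WT Q S, symmetric] WA
      assoc_mult_mat[OF D WT Q] by simp
qed

lemma conjugated_diag_col_eigenvector:
  fixes U :: "real mat"
  assumes U: "U \<in> carrier_mat n n" "U\<^sup>T * U = 1\<^sub>m n" and i: "i < n"
  shows "U * mat_diag n d * U\<^sup>T *\<^sub>v col U i = d i \<cdot>\<^sub>v col U i" "vec_norm2 (col U i) = 1"
proof -
  have UT: "U\<^sup>T \<in> carrier_mat n n" using U by simp
  let ?e = "unit_vec n i :: real vec"
  have e: "?e \<in> carrier_vec n" by simp
  have c: "col U i = U *\<^sub>v ?e" using U i by (intro eq_vecI) auto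
  have UTc: "U\<^sup>T *\<^sub>v col U i = ?e"
    unfolding c assoc_mult_mat_vec[OF UT U(1) e, symmetric] U(2) by simp
  have "mat_diag n d *\<^sub>v ?e = d i \<cdot>\<^sub>v ?e"
    unfolding mat_diag_mult_vec[OF e] using i by (intro eq_vecI) auto
  then show "U * mat_diag n d * U\<^sup>T *\<^sub>v col U i = d i \<cdot>\<^sub>v col U i"
    using conjugated_diag_mult_vec[OF U(1), of "col U i" d] UTc mult_mat_vec[OF U(1) e, of "d i"] c U(1) by auto
  have "vec_norm2 ?e = 1"
    using vec_norm2_power2[of ?e] vec_norm2_nonneg[of ?e] i by (simp add: power2_eq_1_iff)
  then show "vec_norm2 (col U i) = 1" unfolding c vec_norm2_isometry[OF U e] .
qed

lemma scalar_prod_gram: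
  fixes M :: "real mat"
  assumes M: "M \<in> carrier_mat m k" and x: "x \<in> carrier_vec k"
  shows "(vec_norm2 (M *\<^sub>v x))\<^sup>2 = x \<bullet> (M\<^sup>T * M *\<^sub>v x)"
proof -
  have MT: "M\<^sup>T \<in> carrier_mat k m" using M by simp
  show ?thesis
    unfolding vec_norm2_power2 scalar_prod_mult_mat_vec[OF M x mult_mat_vec_carrier[OF M x]]
      assoc_mult_mat_vec[OF MT M x] ..
qed

lemma transpose_isometry_contraction:
  fixes W :: "real mat"
  assumes W: "W \<in> carrier_mat n k" "W\<^sup>T * W = 1\<^sub>m k" and y: "y \<in> carrier_vec n"
  shows "vec_norm2 (W\<^sup>T *\<^sub>v y) \<le> vec_norm2 y"
  using transpose_mult_mat_vec_bound[OF W(1), of 1 y] vec_norm2_isometry[OF W] y by simp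

text \<open>Used to see that an eigenvector of \<open>X\<^sup>T * X\<close> for c is one of
  \<open>Y\<^sup>T * Y\<close> for 1 - c.\<close>

lemma smult_add_eq_self_imp:
  fixes u w :: "real vec"
  assumes "c \<cdot>\<^sub>v u + w = u" "u \<in> carrier_vec k" "w \<in> carrier_vec k"
  shows "w = (1 - c) \<cdot>\<^sub>v u"
proof (rule eq_vecI)
  fix l assume l: "l < dim_vec ((1 - c) \<cdot>\<^sub>v u)"
  have "(c \<cdot>\<^sub>v u + w) $ l = u $ l" unfolding assms(1) ..
  then show "w $ l = ((1 - c) \<cdot>\<^sub>v u) $ l" using l assms(2,3) by (simp add: algebra_simps)
qed (use assms(2,3) in simp)

theorem proposition3:
  fixes n r :: nat
    and A V Vp Q S E :: "real mat"
    and lam :: "nat \<Rightarrow> real"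
    and gap :: real
  assumes r_ge: "1 \<le> r" and r_less: "r < n"
    and A_dim: "A \<in> carrier_mat n n"
    and A_sym: "transpose_mat A = A"
    and V_dim: "V \<in> carrier_mat n r"
    and Vp_dim: "Vp \<in> carrier_mat n (n - r)"
    and V_Vp_orth: "real_orthogonal n (append_columns V Vp)"
    \<comment> \<open>0-based indexing: \<open>lam k\<close> is the (k+1)-st eigenvalue\<close>
    and A_decomp: "A = V * mat_diag r lam * transpose_mat V
           + Vp * mat_diag (n - r) (\<lambda>k. lam (r + k)) * transpose_mat Vp"
    and lam_decr: "\<And>i j. i \<le> j \<Longrightarrow> j < n \<Longrightarrow> lam j \<le> lam i"
    and lam_gap: "lam r < lam (r - 1)"
    and lam_abs: "Max ((\<lambda>k. \<bar>lam k\<bar>) ` {r..<n}) < Min ((\<lambda>k. \<bar>lam k\<bar>) ` {..<r})"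
    and Q_dim: "Q \<in> carrier_mat n r"
    and Q_orth: "orthonormal_cols Q"
    and S_dim: "S \<in> carrier_mat r r"
    and S_diag: "diagonal_mat S"
    and E_dim: "E \<in> carrier_mat n r"
    and residual: "A * Q - Q * S = E"
    and gap_eq: "gap = min (lam (r - 1) - lam r)
           (sep_2_inf Vp (mat_diag r lam)
              (Vp * mat_diag (n - r) (\<lambda>k. lam (r + k)) * transpose_mat Vp))"
    and leading: "leading_invariant_subspace r (A - E * transpose_mat Q) (mat_range Q)"
    and E_small: "spectral_norm E \<le> gap / 5"
  shows "dist_2_inf V Q
     \<le> 8 * norm_2_inf V * (spectral_norm E / (lam (r - 1) - lam r))\<^sup>2
       + 2 * norm_inf (Vp * transpose_mat Vp) * (norm_2_inf E / gap)
           * (1 + 2 * spectral_norm E / (lam (r - 1) - lam r))"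
proof -
  define p where "p = n - r"
  define L where "L = mat_diag r lam"
  define Lp where "Lp = mat_diag p (\<lambda>k. lam (r + k))"
  define C where "C = Vp * Lp * Vp\<^sup>T"
  define \<epsilon> where "\<epsilon> = spectral_norm E"
  define \<delta> where "\<delta> = lam (r - 1) - lam r"
  have n: "0 < n" "n = r + p" and p: "0 < p" and rn: "r \<le> n" using r_ge r_less by (auto simp: p_def)
  have Vp: "Vp \<in> carrier_mat n p" using Vp_dim by (simp add: p_def)
  note V = V_dim and Q = Q_dim and S = S_dim and E = E_dim and A = A_dim
  have L: "L \<in> carrier_mat r r" and Lp: "Lp \<in> carrier_mat p p" by (simp_all add: L_def Lp_def)
  have A_eq: "A = V * L * V\<^sup>T + C" using A_decomp by (simp add: L_def Lp_def C_def p_def)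
  have VT: "V\<^sup>T \<in> carrier_mat r n" and VpT: "Vp\<^sup>T \<in> carrier_mat p n" and QT: "Q\<^sup>T \<in> carrier_mat r n"
    using V Vp Q by auto
  have C: "C \<in> carrier_mat n n" unfolding C_def by (rule mult_carrier_mat[OF mult_carrier_mat[OF Vp Lp] VpT])
  have VLV: "V * L * V\<^sup>T \<in> carrier_mat n n" by (rule mult_carrier_mat[OF mult_carrier_mat[OF V L] VT])
  note orth = append_columns_orthogonal[OF V Vp n(2) V_Vp_orth]
  have QQ: "Q\<^sup>T * Q = 1\<^sub>m r" using Q_orth Q by (simp add: orthonormal_cols_def)
  have VA: "V\<^sup>T * A = L * V\<^sup>T"
    unfolding A_eq C_def by (rule transpose_mult_spectral_sum[OF V Vp L Lp orth(1,3)])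
  have VpA: "Vp\<^sup>T * A = Lp * Vp\<^sup>T"
    unfolding A_eq comm_add_mat[OF VLV C] unfolding C_def
    by (rule transpose_mult_spectral_sum[OF Vp V Lp L orth(2,4)])

  \<comment> \<open>Coordinates of \<open>Q\<close> in the eigenbasis and their Sylvester
    equations\<close>
  define X where "X = V\<^sup>T * Q"
  define Y where "Y = Vp\<^sup>T * Q"
  have X: "X \<in> carrier_mat r r" and Y: "Y \<in> carrier_mat p r"
    unfolding X_def Y_def by (rule mult_carrier_mat[OF VT Q] mult_carrier_mat[OF VpT Q])+
  have XT: "X\<^sup>T \<in> carrier_mat r r" and YT: "Y\<^sup>T \<in> carrier_mat r p" using X Y by auto
  have LX: "L * X - X * S = V\<^sup>T * E"
    unfolding X_def by (rule compressed_residual[OF A Q S residual V L VA])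
  have LY: "Lp * Y - Y * S = Vp\<^sup>T * E"
    unfolding Y_def by (rule compressed_residual[OF A Q S residual Vp Lp VpA])
  have VE: "V\<^sup>T * E \<in> carrier_mat r r" and VpE: "Vp\<^sup>T * E \<in> carrier_mat p r"
    by (rule mult_carrier_mat[OF VT E] mult_carrier_mat[OF VpT E])+
  have VX_VpY: "V * X + Vp * Y = Q"
  proof -
    have "V * X + Vp * Y = V * V\<^sup>T * Q + Vp * Vp\<^sup>T * Q"
      unfolding X_def Y_def assoc_mult_mat[OF V VT Q] assoc_mult_mat[OF Vp VpT Q] ..
    also have "\<dots> = (V * V\<^sup>T + Vp * Vp\<^sup>T) * Q"
      by (rule add_mult_distrib_mat[OF mult_carrier_mat[OF V VT] mult_carrier_mat[OF Vp VpT] Q, symmetric])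
    finally show ?thesis unfolding orth(5) using Q by simp
  qed
  \<comment> \<open>Squared cosines and sines of the principal angles between the spans of
    \<open>V\<close> and \<open>Q\<close> add up to one.\<close>
  have gram: "X\<^sup>T * X + Y\<^sup>T * Y = 1\<^sub>m r"
  proof -
    have "X\<^sup>T * X + Y\<^sup>T * Y = Q\<^sup>T * (V * X) + Q\<^sup>T * (Vp * Y)"
      using transpose_mult[OF VT Q] transpose_mult[OF VpT Q] assoc_mult_mat[OF QT V X] assoc_mult_mat[OF QT Vp Y]
      by (simp add: X_def[symmetric] Y_def[symmetric])
    also have "\<dots> = Q\<^sup>T * Q"
      unfolding mult_add_distrib_mat[OF QT mult_carrier_mat[OF V X] mult_carrier_mat[OF Vp Y], symmetric]
        VX_VpY ..
    finally show ?thesis unfolding QQ .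
  qed
  have XXc: "X\<^sup>T * X \<in> carrier_mat r r" and YYc: "Y\<^sup>T * Y \<in> carrier_mat r r" using X Y by auto
  have gram_vec: "X\<^sup>T * X *\<^sub>v x + Y\<^sup>T * Y *\<^sub>v x = x" if "x \<in> carrier_vec r" for x
    using add_mult_distrib_mat_vec[OF XXc YYc that] gram that by simp
  have pyth: "(vec_norm2 (X *\<^sub>v x))\<^sup>2 + (vec_norm2 (Y *\<^sub>v x))\<^sup>2 = (vec_norm2 x)\<^sup>2"
    if x: "x \<in> carrier_vec r" for x
  proof -
    have "x \<bullet> x = x \<bullet> (X\<^sup>T * X *\<^sub>v x + Y\<^sup>T * Y *\<^sub>v x)" using gram_vec[OF x] by simp
    also have "\<dots> = x \<bullet> (X\<^sup>T * X *\<^sub>v x) + x \<bullet> (Y\<^sup>T * Y *\<^sub>v x)"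
      using mult_mat_vec_carrier[OF XXc x] mult_mat_vec_carrier[OF YYc x]
      by (rule scalar_prod_add_distrib[OF x])
    finally show ?thesis unfolding scalar_prod_gram[OF X x] scalar_prod_gram[OF Y x] using vec_norm2_power2[of x] by simp
  qed

  \<comment> \<open>Size relations between residual, eigenvalue gap and \<open>gap\<close>\<close>
  have \<epsilon>0: "0 \<le> \<epsilon>" unfolding \<epsilon>_def using spectral_norm_nonneg[of E] E r_ge by simp
  have \<delta>0: "0 < \<delta>" using lam_gap by (simp add: \<delta>_def)
  have gap\<delta>: "gap \<le> \<delta>" and gap_sep: "gap \<le> sep_2_inf Vp L C"
    using gap_eq by (simp_all add: \<delta>_def L_def C_def Lp_def p_def)
  have \<epsilon>gap: "\<epsilon> \<le> gap / 5" using E_small by (simp add: \<epsilon>_def)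
  \<comment> \<open>Only nonnegativity of \<open>gap\<close> is derived, from
    \<open>0 \<le> \<epsilon>\<close>; the later division by it therefore distinguishes two
    cases.\<close>
  have gap0: "0 \<le> gap" using \<epsilon>0 \<epsilon>gap by simp
  have E_bound: "vec_norm2 (E *\<^sub>v x) \<le> \<epsilon> * vec_norm2 x" if "x \<in> carrier_vec r" for x
    unfolding \<epsilon>_def by (rule vec_norm2_mult_mat_vec_le_spectral_norm[OF E that])
  have WE_bound: "vec_norm2 (W\<^sup>T * E *\<^sub>v x) \<le> \<epsilon> * vec_norm2 x"
    if W: "W \<in> carrier_mat n k" "W\<^sup>T * W = 1\<^sub>m k" and x: "x \<in> carrier_vec r" for W k x
  proof -
    have WT: "W\<^sup>T \<in> carrier_mat k n" using W by simp
    have "vec_norm2 (W\<^sup>T * E *\<^sub>v x) \<le> vec_norm2 (E *\<^sub>v x)"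
      unfolding assoc_mult_mat_vec[OF WT E x]
      by (rule transpose_isometry_contraction[OF W mult_mat_vec_carrier[OF E x]])
    with E_bound[OF x] show ?thesis by simp
  qed

  \<comment> \<open>Ritz value bound and the size of the squared sines\<close>
  define s where "s = (\<lambda>j. S $$ (j, j))"
  have S_eq: "S = mat_diag r s" unfolding s_def by (rule diagonal_mat_eq_mat_diag[OF S S_diag])
  define \<alpha> where "\<alpha> = lam (r - 1) - 2 * \<epsilon>"
  have s_ge: "\<alpha> \<le> s j" if j: "j < r" for j
    unfolding \<alpha>_def s_def \<epsilon>_def
  proof (rule ritz_value_ge[OF A A_sym Q QQ V orth(1) _ _ S S_diag E rn residual leading j])
    show "V\<^sup>T * A * V = mat_diag r lam"
      unfolding VA assoc_mult_mat[OF L VT V] orth(1) right_mult_one_mat[OF L] by (simp add: L_def)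
    show "lam (r - 1) \<le> lam i" if "i < r" for i using lam_decr[of i "r - 1"] that rn r_less by simp
  qed
  \<comment> \<open>The Davis--Kahan bound for the squared norm of \<open>Y\<close>: entries of
    \<open>S\<close> are at least \<alpha>, trailing eigenvalues of \<open>A\<close> at most
    \<open>lam r\<close>.\<close>
  define \<tau> where "\<tau> = (\<epsilon> / (\<alpha> - lam r))\<^sup>2"
  have \<epsilon>\<delta>: "5 * \<epsilon> \<le> \<delta>" using \<epsilon>gap gap\<delta> by simp
  \<comment> \<open>\<alpha> - lam r = \<delta> - 2 \<epsilon>, and 5 \<epsilon> \<le> \<delta>
    leaves three fifths of \<delta>.\<close>
  have \<alpha>_gap: "3 * \<delta> \<le> 5 * (\<alpha> - lam r)" using \<epsilon>\<delta> by (simp add: \<alpha>_def \<delta>_def)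
  have \<eta>0: "0 < \<alpha> - lam r" using \<alpha>_gap \<delta>0 by simp
  have \<tau>0: "0 \<le> \<tau>" by (simp add: \<tau>_def)
  have ratio: "\<epsilon> / (\<alpha> - lam r) \<le> 5 / 3 * (\<epsilon> / \<delta>)"
  proof -
    have "\<epsilon> * (3 * \<delta>) \<le> \<epsilon> * (5 * (\<alpha> - lam r))" using \<alpha>_gap \<epsilon>0 by (rule mult_left_mono)
    then show ?thesis using \<eta>0 \<delta>0 by (simp add: field_simps)
  qed
  have "\<tau> \<le> (5 / 3 * (\<epsilon> / \<delta>))\<^sup>2"
    unfolding \<tau>_def using ratio \<epsilon>0 \<eta>0 by (intro power_mono) auto
  then have \<tau>\<delta>: "\<tau> \<le> 25 / 9 * (\<epsilon> / \<delta>)\<^sup>2" unfolding power_mult_distrib by (simp add: power2_eq_square)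
  have "\<epsilon> / \<delta> \<le> 1 / 5" using \<epsilon>\<delta> \<delta>0 by (simp add: field_simps)
  then have "(\<epsilon> / \<delta>)\<^sup>2 \<le> (1 / 5)\<^sup>2" using \<epsilon>0 \<delta>0 by (intro power_mono) auto
  also have "(1 / 5)\<^sup>2 = (1 / 25 :: real)" by (simp add: power2_eq_square)
  finally have \<tau>9: "\<tau> \<le> 1 / 9" using \<tau>\<delta> by linarith

  \<comment> \<open>Spectral bounds for \<open>X\<close> and \<open>Y\<close>\<close>
  have "(X\<^sup>T * X)\<^sup>T = X\<^sup>T * X" using transpose_mult[OF XT X] by simp
  then obtain U d where U: "U \<in> carrier_mat r r" "U\<^sup>T * U = 1\<^sub>m r" "U * U\<^sup>T = 1\<^sub>m r"
    and XX: "X\<^sup>T * X = U * mat_diag r d * U\<^sup>T"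
    using symmetric_diagonalization[OF XXc] by metis
  have d: "0 \<le> 1 - d i" "1 - d i \<le> \<tau>" if i: "i < r" for i
  proof -
    let ?u = "col U i"
    have u: "?u \<in> carrier_vec r" using U i by auto
    have "X\<^sup>T * X *\<^sub>v ?u = d i \<cdot>\<^sub>v ?u"
      unfolding XX by (rule conjugated_diag_col_eigenvector(1)[OF U(1,2) i])
    with gram_vec[OF u] have dec: "d i \<cdot>\<^sub>v ?u + Y\<^sup>T * Y *\<^sub>v ?u = ?u" by simp
    \<comment> \<open>By \<open>gram_vec\<close> the Gram matrices of \<open>X\<close> and
      \<open>Y\<close> share eigenvectors, so the Davis--Kahan estimate for \<open>Y\<close>
      controls the spectrum of \<open>X\<^sup>T * X\<close>.\<close>
    have Yu: "Y\<^sup>T * Y *\<^sub>v ?u = (1 - d i) \<cdot>\<^sub>v ?u"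
      by (rule smult_add_eq_self_imp[OF dec u mult_mat_vec_carrier[OF YYc u]])
    have "lam (r + k) \<le> lam r" if "k < p" for k using lam_decr[of r "r + k"] that n by simp
    note * = sylvester_gram_eigenvalue_le[OF Y VpE LY[unfolded Lp_def S_eq] this s_ge _ WE_bound[OF Vp orth(2)]
      u conjugated_diag_col_eigenvector(2)[OF U(1,2) i] Yu]
    show "0 \<le> 1 - d i" "1 - d i \<le> \<tau>" using * \<eta>0 by (simp_all add: \<tau>_def)
  qed
  have Xlow: "(1 - \<tau>) * (vec_norm2 x)\<^sup>2 \<le> (vec_norm2 (X *\<^sub>v x))\<^sup>2" if x: "x \<in> carrier_vec r" for x
  proof -
    let ?z = "U\<^sup>T *\<^sub>v x"
    have UT: "U\<^sup>T \<in> carrier_mat r r" using U by simp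
    have z: "?z \<in> carrier_vec r" by (rule mult_mat_vec_carrier[OF UT x])
    have "vec_norm2 ?z = vec_norm2 x" using U(3) by (intro vec_norm2_isometry[OF UT _ x]) simp
    then have "(1 - \<tau>) * (vec_norm2 x)\<^sup>2 = (\<Sum>i<r. (1 - \<tau>) * (?z $ i)\<^sup>2)"
      using vec_norm2_power2_eq_sum[OF z] unfolding sum_distrib_left[symmetric] by simp
    also have "\<dots> \<le> (\<Sum>i<r. d i * (?z $ i)\<^sup>2)"
      using d by (intro sum_mono mult_right_mono) (auto simp: algebra_simps)
    also have "\<dots> = (vec_norm2 (X *\<^sub>v x))\<^sup>2"
      unfolding scalar_prod_gram[OF X x] by (rule quadratic_form_diagonalization[OF U(1) x XX, symmetric])
    finally show ?thesis .
  qed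
  have Ybound: "vec_norm2 (Y *\<^sub>v x) \<le> sqrt \<tau> * vec_norm2 x" if x: "x \<in> carrier_vec r" for x
  proof (rule power2_le_imp_le)
    show "(vec_norm2 (Y *\<^sub>v x))\<^sup>2 \<le> (sqrt \<tau> * vec_norm2 x)\<^sup>2"
      using pyth[OF x] Xlow[OF x] \<tau>0 by (simp add: power_mult_distrib algebra_simps)
  qed (simp add: \<tau>0)
  \<comment> \<open>1 - \<tau> \<ge> 8/9 \<ge> (8/9)^2, which avoids a square root in the
    constant.\<close>
  have Xlow': "8 / 9 * vec_norm2 x \<le> vec_norm2 (X *\<^sub>v x)" if x: "x \<in> carrier_vec r" for x
  proof (rule power2_le_imp_le)
    have "(8 / 9 * vec_norm2 x)\<^sup>2 \<le> (1 - \<tau>) * (vec_norm2 x)\<^sup>2"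
      unfolding power_mult_distrib using \<tau>9 by (intro mult_right_mono) (auto simp: power2_eq_square)
    then show "(8 / 9 * vec_norm2 x)\<^sup>2 \<le> (vec_norm2 (X *\<^sub>v x))\<^sup>2"
      using Xlow[OF x] by (rule order_trans)
  qed simp
  have Xup: "vec_norm2 (X *\<^sub>v x) \<le> vec_norm2 x" if x: "x \<in> carrier_vec r" for x
    by (rule power2_le_imp_le) (use pyth[OF x] zero_le_power2[of "vec_norm2 (Y *\<^sub>v x)"] in \<open>linarith, simp\<close>)

  \<comment> \<open>The aligning rotation \<open>R\<close>\<close>
  have "0 < d i" "d i \<le> 1" "1 - d i \<le> \<tau>" if "i < r" for i using d[OF that] \<tau>9 by auto
  from near_orthogonal_polar_factor[OF X U XX this \<tau>0]
  obtain R where R: "real_orthogonal r R" "R * R\<^sup>T = 1\<^sub>m r"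
    and XR: "\<forall>x\<in>carrier_vec r. vec_norm2 (x - (X * R)\<^sup>T *\<^sub>v x) \<le> \<tau> * vec_norm2 x"
    by auto
  have Rc: "R \<in> carrier_mat r r" using R(1) by (simp add: real_orthogonal_def)
  have RT: "R\<^sup>T \<in> carrier_mat r r" using Rc by simp

  \<comment> \<open>Sylvester equation with \<open>L\<close> for the aligned component\<close>
  define Z where "Z = Vp * Y"
  define W where "W = Z * X\<^sup>T"
  define K where "K = norm_inf (Vp * Vp\<^sup>T) * norm_2_inf E"
  define z where "z = norm_2_inf Z"
  have Z: "Z \<in> carrier_mat n r" unfolding Z_def by (rule mult_carrier_mat[OF Vp Y])
  have W: "W \<in> carrier_mat n r" unfolding W_def by (rule mult_carrier_mat[OF Z XT])
  have z0: "0 \<le> z" unfolding z_def by (rule norm_2_inf_nonneg[OF Z n(1)])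
  have VpVp: "Vp * Vp\<^sup>T \<in> carrier_mat n n" by (rule mult_carrier_mat[OF Vp VpT])
  let ?F = "Vp * (Vp\<^sup>T * E)" and ?G = "(V\<^sup>T * E)\<^sup>T"
  have F: "?F \<in> carrier_mat n r" by (rule mult_carrier_mat[OF Vp VpE])
  have G: "?G \<in> carrier_mat r r" using VE by simp
  have FX: "?F * X\<^sup>T \<in> carrier_mat n r" by (rule mult_carrier_mat[OF F XT])
  have ZG: "Z * ?G \<in> carrier_mat n r" by (rule mult_carrier_mat[OF Z G])
  have add_back: "M = N + P" if "M - P = N" "M \<in> carrier_mat k l" "P \<in> carrier_mat k l" for M N P :: "real mat" and k l
    using that by (intro eq_matI) auto
  have SX: "S * X\<^sup>T \<in> carrier_mat r r" by (rule mult_carrier_mat[OF S XT])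
  have ZSX: "Z * (S * X\<^sup>T) \<in> carrier_mat n r" by (rule mult_carrier_mat[OF Z SX])
  have sylvester: "W * L - C * W = Z * ?G - ?F * X\<^sup>T"
  proof -
    have XS: "X * S \<in> carrier_mat r r" and YS: "Y * S \<in> carrier_mat p r"
      by (rule mult_carrier_mat[OF X S] mult_carrier_mat[OF Y S])+
    have LXc: "L * X \<in> carrier_mat r r" and LpYc: "Lp * Y \<in> carrier_mat p r"
      by (rule mult_carrier_mat[OF L X] mult_carrier_mat[OF Lp Y])+
    have LT: "L\<^sup>T = L" "S\<^sup>T = S"
      by (rule eq_matI; auto simp: L_def mat_diag_def) (subst (1 2) S_eq, rule eq_matI; auto simp: mat_diag_def)
    \<comment> \<open>Transposing the equation for \<open>X\<close>, with \<open>L\<close> and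
      \<open>S\<close> symmetric, makes \<open>L\<close> on the right of \<open>X\<^sup>T\<close>
      interchangeable with \<open>S\<close> on its left.\<close>
    have "X\<^sup>T * L = (L * X)\<^sup>T" using transpose_mult[OF L X] LT by simp
    also have "\<dots> = (V\<^sup>T * E + X * S)\<^sup>T" using add_back[OF LX LXc XS] by simp
    also have "\<dots> = ?G + S * X\<^sup>T"
      using transpose_add[OF VE XS] transpose_mult[OF X S] LT by simp
    finally have XL: "X\<^sup>T * L = ?G + S * X\<^sup>T" .
    have WL: "W * L = Z * ?G + Z * (S * X\<^sup>T)"
      unfolding W_def assoc_mult_mat[OF Z XT L] XL by (rule mult_add_distrib_mat[OF Z G SX])
    have "C * Z = Vp * Lp * (Vp\<^sup>T * Vp) * Y"
      unfolding C_def Z_def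
      using assoc_mult_mat[OF mult_carrier_mat[OF Vp Lp] VpT Z[unfolded Z_def]]
        assoc_mult_mat[OF VpT Vp Y] assoc_mult_mat[OF mult_carrier_mat[OF Vp Lp] mult_carrier_mat[OF VpT Vp] Y]
      by simp
    also have "\<dots> = Vp * (Lp * Y)"
      unfolding orth(2) right_mult_one_mat[OF mult_carrier_mat[OF Vp Lp]] by (rule assoc_mult_mat[OF Vp Lp Y])
    also have "Lp * Y = Vp\<^sup>T * E + Y * S" by (rule add_back[OF LY LpYc YS])
    also have "Vp * (Vp\<^sup>T * E + Y * S) = ?F + Z * S"
      using mult_add_distrib_mat[OF Vp VpE YS] assoc_mult_mat[OF Vp Y S] by (simp add: Z_def)
    finally have CZ: "C * Z = ?F + Z * S" .
    have "C * W = (?F + Z * S) * X\<^sup>T"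
      unfolding W_def assoc_mult_mat[OF C Z XT, symmetric] CZ ..
    also have "\<dots> = ?F * X\<^sup>T + Z * (S * X\<^sup>T)"
      using add_mult_distrib_mat[OF F mult_carrier_mat[OF Z S] XT] assoc_mult_mat[OF Z S XT] by simp
    finally have CW: "C * W = ?F * X\<^sup>T + Z * (S * X\<^sup>T)" .
    \<comment> \<open>\<open>Z * (S * X\<^sup>T)\<close> occurs in both \<open>W * L\<close> and
      \<open>C * W\<close>; after cancellation \<open>S\<close> is gone.\<close>
    have cancel: "M + P - (N + P) = M - N"
      if "M \<in> carrier_mat n r" "N \<in> carrier_mat n r" "P \<in> carrier_mat n r" for M N P :: "real mat"
      using that by (intro eq_matI) auto
    show ?thesis unfolding WL CW by (rule cancel[OF ZG FX ZSX])
  qed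

  \<comment> \<open>Bounding \<open>Z\<close> by the separation\<close>
  have "sep_2_inf Vp L C * norm_2_inf W \<le> norm_2_inf (W * L - C * W)"
  proof (rule sep_2_inf_le[OF C L W n(1) Vp])
    fix j assume j: "j < r"
    have YX: "Y * X\<^sup>T \<in> carrier_mat p r" by (rule mult_carrier_mat[OF Y XT])
    have "col W j = Vp *\<^sub>v col (Y * X\<^sup>T) j"
      unfolding W_def Z_def assoc_mult_mat[OF Vp Y XT] by (rule col_mult2[OF Vp YX j])
    moreover have "col (Y * X\<^sup>T) j \<in> carrier_vec p" using YX j by auto
    ultimately show "col W j \<in> mat_range Vp" using Vp unfolding mat_range_def by auto
  qed
  also have "\<dots> \<le> \<epsilon> * z + K"
  proof (rule norm_2_inf_le[OF _ n(1)])
    show "W * L - C * W \<in> carrier_mat n r" using mult_carrier_mat[OF C W] by (rule minus_carrier_mat)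
    fix i assume i: "i < n"
    note Zi = row_carrier_vec[OF i Z] and Fi = row_carrier_vec[OF i F]
    have ri: "row (Z * ?G - ?F * X\<^sup>T) i = row (Z * ?G) i - row (?F * X\<^sup>T) i"
      by (rule row_minus[OF ZG FX i])
    \<comment> \<open>A row of this product is \<open>V\<^sup>T * E\<close> applied to a row of
      \<open>Z\<close>, so the spectral norm of \<open>E\<close> suffices; below, \<open>X\<close>
      acts on the rows of \<open>?F\<close> as a contraction.\<close>
    have "vec_norm2 (row (Z * ?G) i) \<le> \<epsilon> * vec_norm2 (row Z i)"
      using row_mult[OF Z G i] WE_bound[OF V orth(1) Zi] by simp
    also have "\<dots> \<le> \<epsilon> * z" unfolding z_def using vec_norm2_row_le[OF Z i] \<epsilon>0 by (rule mult_left_mono)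
    finally have 1: "vec_norm2 (row (Z * ?G) i) \<le> \<epsilon> * z" .
    have "vec_norm2 (row (?F * X\<^sup>T) i) \<le> vec_norm2 (row ?F i)"
      using row_mult[OF F XT i] Xup[OF Fi] by simp
    also have "\<dots> \<le> norm_2_inf ?F" by (rule vec_norm2_row_le[OF F i])
    also have "\<dots> \<le> K"
      unfolding K_def assoc_mult_mat[OF Vp VpT E, symmetric] by (rule norm_2_inf_mult_le[OF VpVp E n(1) n(1)])
    finally have 2: "vec_norm2 (row (?F * X\<^sup>T) i) \<le> K" .
    have "vec_norm2 (row (Z * ?G) i - row (?F * X\<^sup>T) i) \<le> vec_norm2 (row (Z * ?G) i) + vec_norm2 (row (?F * X\<^sup>T) i)"
      by (rule vec_norm2_diff_le[OF row_carrier_vec[OF i ZG] row_carrier_vec[OF i FX]])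
    then show "vec_norm2 (row (W * L - C * W) i) \<le> \<epsilon> * z + K"
      unfolding sylvester ri using 1 2 by linarith
  qed
  finally have sepW: "sep_2_inf Vp L C * norm_2_inf W \<le> \<epsilon> * z + K" .
  \<comment> \<open>Row i of \<open>W\<close> is \<open>X\<close> applied to row i of
    \<open>Z\<close>; the lower bound on \<open>X\<close> is used at a row where the norm of
    \<open>Z\<close> is attained.\<close>
  have Wlow: "8 / 9 * z \<le> norm_2_inf W"
  proof -
    obtain i where i: "i < n" "norm_2_inf Z = vec_norm2 (row Z i)" using norm_2_inf_attained[OF Z n(1)] .
    note Zi = row_carrier_vec[OF i(1) Z]
    have "8 / 9 * z \<le> vec_norm2 (row W i)"
      using Xlow'[OF Zi] row_mult[OF Z XT i(1)] i(2) by (simp add: W_def z_def)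
    also have "\<dots> \<le> norm_2_inf W" by (rule vec_norm2_row_le[OF W i(1)])
    finally show ?thesis .
  qed
  have "gap * (8 / 9 * z) \<le> sep_2_inf Vp L C * norm_2_inf W"
    using gap_sep gap0 Wlow z0 by (intro mult_mono) auto
  also have "\<dots> \<le> gap / 5 * z + K" using sepW mult_right_mono[OF \<epsilon>gap z0] by simp
  \<comment> \<open>8/9 - 1/5 = 31/45: the term with \<open>z\<close> is absorbed on the left, and
    31/45 \<ge> 1/2 gives the factor 2 next.\<close>
  finally have "31 / 45 * (gap * z) \<le> K" by (simp add: algebra_simps)
  moreover have gz: "0 \<le> gap * z" using gap0 z0 by simp
  ultimately have gapz: "gap * z \<le> 2 * K" by linarith
  have K0: "0 \<le> K" using \<open>31 / 45 * (gap * z) \<le> K\<close> gz by linarith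
  have z_le: "z \<le> 2 * (K / gap)"
  proof (cases "gap = 0")
    case True
    \<comment> \<open>then \<open>\<epsilon> = 0\<close>, so \<open>Y = 0\<close>, in accordance with \<open>K / 0 = 0\<close>\<close>
    then have "\<tau> = 0" using \<epsilon>gap \<epsilon>0 by (simp add: \<tau>_def)
    have "z \<le> 0"
      unfolding z_def
    proof (rule norm_2_inf_le[OF Z n(1)])
      fix i assume i: "i < n"
      note Vi = row_carrier_vec[OF i Vp]
      show "vec_norm2 (row Z i) \<le> 0"
        using transpose_mult_mat_vec_bound[OF Y order_refl _ Vi] Ybound \<open>\<tau> = 0\<close>
        by (simp add: Z_def row_mult[OF Vp Y i])
    qed
    then show ?thesis using True by simp
  next
    case False
    then show ?thesis using gap0 gapz by (simp add: field_simps)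
  qed

  \<comment> \<open>Assembling the distance bound\<close>
  have "dist_2_inf V Q \<le> norm_2_inf (V - Q * R)" by (rule dist_2_inf_le[OF V Q R(1) n(1)])
  also have "\<dots> \<le> \<tau> * norm_2_inf V + z"
  proof (rule norm_2_inf_le[OF _ n(1)])
    show "V - Q * R \<in> carrier_mat n r" using mult_carrier_mat[OF Q Rc] by (rule minus_carrier_mat)
    fix i assume i: "i < n"
    have XRc: "X * R \<in> carrier_mat r r" by (rule mult_carrier_mat[OF X Rc])
    have VXR: "V * (X * R) \<in> carrier_mat n r" and ZR: "Z * R \<in> carrier_mat n r"
      by (rule mult_carrier_mat[OF V XRc] mult_carrier_mat[OF Z Rc])+
    have "Q * R = (V * X + Z) * R" using VX_VpY by (simp add: Z_def)
    also have "\<dots> = V * (X * R) + Z * R"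
      using add_mult_distrib_mat[OF mult_carrier_mat[OF V X] Z Rc] assoc_mult_mat[OF V X Rc] by simp
    finally have QR: "Q * R = V * (X * R) + Z * R" .
    note Vi = row_carrier_vec[OF i V] and Zi = row_carrier_vec[OF i Z]
    \<comment> \<open>V - Q R = V (1 - X R) - Z R, read row by row: the first part is quadratically
      small by the choice of \<open>R\<close>, and the isometry \<open>R\<^sup>T\<close> leaves row
      norms of \<open>Z\<close> unchanged.\<close>
    have "row (V - Q * R) i = (row V i - row (V * (X * R)) i) - row (Z * R) i"
      unfolding QR by (rule row_minus_add[OF V VXR ZR i])
    also have "\<dots> = (row V i - (X * R)\<^sup>T *\<^sub>v row V i) - R\<^sup>T *\<^sub>v row Z i"
      unfolding row_mult[OF V XRc i] row_mult[OF Z Rc i] ..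
    finally have "vec_norm2 (row (V - Q * R) i)
        \<le> vec_norm2 (row V i - (X * R)\<^sup>T *\<^sub>v row V i) + vec_norm2 (R\<^sup>T *\<^sub>v row Z i)"
      using vec_norm2_diff_le[of "row V i - (X * R)\<^sup>T *\<^sub>v row V i" r "R\<^sup>T *\<^sub>v row Z i"]
        Vi mult_mat_vec_carrier[OF RT Zi] mult_mat_vec_carrier[of "(X * R)\<^sup>T" r r "row V i"] XRc
      by simp
    also have "vec_norm2 (R\<^sup>T *\<^sub>v row Z i) = vec_norm2 (row Z i)"
      using R(2) by (intro vec_norm2_isometry[OF RT _ Zi]) simp
    also have "vec_norm2 (row V i - (X * R)\<^sup>T *\<^sub>v row V i) + vec_norm2 (row Z i)
        \<le> \<tau> * vec_norm2 (row V i) + z"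
      using bspec[OF XR Vi] vec_norm2_row_le[OF Z i] by (simp add: z_def)
    also have "\<dots> \<le> \<tau> * norm_2_inf V + z"
      using vec_norm2_row_le[OF V i] \<tau>0 by (simp add: mult_left_mono)
    finally show "vec_norm2 (row (V - Q * R) i) \<le> \<tau> * norm_2_inf V + z" .
  qed
  also have "\<tau> * norm_2_inf V + z
      \<le> 8 * norm_2_inf V * (\<epsilon> / \<delta>)\<^sup>2 + 2 * (K / gap) * (1 + 2 * \<epsilon> / \<delta>)"
  proof (rule add_mono)
    \<comment> \<open>25/9 \<le> 8 here; in the linear term the factor 1 + 2 \<epsilon>/\<delta> is
      at least one.\<close>
    have "\<tau> \<le> 8 * (\<epsilon> / \<delta>)\<^sup>2" using \<tau>\<delta> zero_le_power2[of "\<epsilon> / \<delta>"] by linarith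
    from mult_right_mono[OF this norm_2_inf_nonneg[OF V n(1)]]
    show "\<tau> * norm_2_inf V \<le> 8 * norm_2_inf V * (\<epsilon> / \<delta>)\<^sup>2" by (simp add: algebra_simps)
    have "2 * (K / gap) * 1 \<le> 2 * (K / gap) * (1 + 2 * \<epsilon> / \<delta>)"
      using K0 gap0 \<epsilon>0 \<delta>0 by (intro mult_left_mono) auto
    with z_le show "z \<le> 2 * (K / gap) * (1 + 2 * \<epsilon> / \<delta>)" by simp
  qed
  finally show ?thesis by (simp add: \<epsilon>_def \<delta>_def K_def)
qed

end
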